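(* Let $H$ and $K$ be complex Hilbert spaces with $\dim K<\infty$. Then $$d(T,S)=\tanh^{-1}\|L_T(S)R_S(T)^{-1}\|$$ defines a metric on $C(H,K)$, and for all $T,S\in C(H,K)$ it satisfies $$d(T,S)=K_{\mathcal B}(\hat T,\hat S).$$
   Context: $C(H,K)$ is the set of all closed densely-defined linear operators from $H$ to $K$. For $T,S\in C(H,K)$ put $$L_T(S)=(I+T^*T)^{1/2}S^*-T^*(I+SS^* )^{1/2},\qquad R_S(T)=(I+TT^* )^{1/2}(I+SS^* )^{1/2}-TS^*;$$ when $\dim K<\infty$, $R_S(T)$ is invertible. $\mathcal B$ denotes the open unit ball of $B(K,H)$ (bounded linear operators from $K$ to $H$, operator norm). For $T\in C(H,K)$, $\hat T=(I+T^*T)^{-1/2}T^*$, which belongs to $\mathcal B$ when $\dim K<\infty$. $K_{\mathcal B}$ is the Kobayashi pseudo-metric on $\mathcal B$: let $\Delta$ be the open unit disc in $\mathbb C$ with Poincaré metric $\omega(a,b)=\tanh^{-1}\frac{|a-b|}{|1-\bar a b|}$. An analytic chain joining $x,y\in\mathcal B$ consists of $n\ge 1$, points $z_1',z_1'',\dots,z_n',z_n''\in\Delta$ and holomorphic maps $f_1,\dots,f_n:\Delta\to\mathcal B$ with $f_1(z_1')=x$, $f_k(z_k'')=f_{k+1}(z_{k+1}')$ for $k=1,\dots,n-1$, and $f_n(z_n'')=y$. Then $K_{\mathcal B}(x,y)=\inf\{\omega(z_1',z_1'')+\dots+\omega(z_n',z_n'')\}$, the infimum being over all analytic chains joining $x$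 and $y$. *)

theory Defs
  imports "HOL-Analysis.Analysis"
begin

class complex_vector = real_vector +
  fixes scaleC :: "complex \<Rightarrow> 'a \<Rightarrow> 'a"  (infixr "*\<^sub>C" 75)
  assumes scaleC_add_right: "a *\<^sub>C (x + y) = a *\<^sub>C x + a *\<^sub>C y"
    and scaleC_add_left: "(a + b) *\<^sub>C x = a *\<^sub>C x + b *\<^sub>C x"
    and scaleC_scaleC: "a *\<^sub>C (b *\<^sub>C x) = (a * b) *\<^sub>C x"
    and scaleC_one: "1 *\<^sub>C x = x"
    and scaleR_scaleC: "r *\<^sub>R x = complex_of_real r *\<^sub>C x"

global_interpretation complex_vector:
  vector_space "scaleC :: complex \<Rightarrow> 'a \<Rightarrow> 'a::complex_vector"
  by unfold_locales (fact scaleC_add_right scaleC_add_left scaleC_scaleC scaleC_one)+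

text \<open>
  The inner product is linear in the first argument. Positive definiteness and
  the relation with the norm come from \<^class>\<open>real_inner\<close> through the last axiom.
\<close>

class complex_inner = complex_vector + real_inner +
  fixes cinner :: "'a \<Rightarrow> 'a \<Rightarrow> complex"
  assumes cinner_add_left: "cinner (x + y) z = cinner x z + cinner y z"
    and cinner_scaleC_left: "cinner (c *\<^sub>C x) y = c * cinner x y"
    and cinner_commute: "cinner x y = cnj (cinner y x)"
    and inner_eq_Re_cinner: "inner x y = Re (cinner x y)"

class complex_hilbert = complex_inner + complete_space

definition finite_dim :: "'a::complex_vector set \<Rightarrow> bool" where
  "finite_dim V \<longleftrightarrow> (\<exists>B. finite B \<and> complex_vector.span B = V)"

text \<open>
  A partially defined operator is identified with its graph. The sum has the
  intersection of the two domains as its domain, the product \<open>A \<odot>\<^sub>o B\<close>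
  (first \<open>B\<close>, then \<open>A\<close>) has the domain of all \<open>x\<close> with \<open>B x\<close> in the domain
  of \<open>A\<close>, and the inverse of an injective operator is the converse relation.
\<close>

definition linear_op :: "('a::complex_vector \<times> 'b::complex_vector) set \<Rightarrow> bool" where
  "linear_op G \<longleftrightarrow>
     (0, 0) \<in> G \<and>
     (\<forall>x y x' y'. (x, y) \<in> G \<longrightarrow> (x', y') \<in> G \<longrightarrow> (x + x', y + y') \<in> G) \<and>
     (\<forall>c x y. (x, y) \<in> G \<longrightarrow> (c *\<^sub>C x, c *\<^sub>C y) \<in> G) \<and>
     single_valued G"

definition densely_defined :: "('a::topological_space \<times> 'b) set \<Rightarrow> bool" where
  "densely_defined G \<longleftrightarrow> closure (Domain G) = UNIV"

definition closed_ops :: "('a::complex_hilbert \<times> 'b::complex_hilbert) set set" where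
  "closed_ops = {G. linear_op G \<and> densely_defined G \<and> closed G}"

definition op_add :: "('a \<times> 'b::plus) set \<Rightarrow> ('a \<times> 'b) set \<Rightarrow> ('a \<times> 'b) set"
    (infixl "\<oplus>\<^sub>o" 65) where
  "A \<oplus>\<^sub>o B = {(x, y + z) | x y z. (x, y) \<in> A \<and> (x, z) \<in> B}"

definition op_diff :: "('a \<times> 'b::minus) set \<Rightarrow> ('a \<times> 'b) set \<Rightarrow> ('a \<times> 'b) set"
    (infixl "\<ominus>\<^sub>o" 65) where
  "A \<ominus>\<^sub>o B = {(x, y - z) | x y z. (x, y) \<in> A \<and> (x, z) \<in> B}"

definition op_comp :: "('b \<times> 'c) set \<Rightarrow> ('a \<times> 'b) set \<Rightarrow> ('a \<times> 'c) set"
    (infixl "\<odot>\<^sub>o" 70) where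
  "A \<odot>\<^sub>o B = B O A"

definition op_adjoint ::
    "('a::complex_inner \<times> 'b::complex_inner) set \<Rightarrow> ('b \<times> 'a) set" where
  "op_adjoint T = {(y, z). \<forall>(x, w)\<in>T. cinner w y = cinner x z}"

definition positive_selfadjoint :: "('a::complex_hilbert \<times> 'a) set \<Rightarrow> bool" where
  "positive_selfadjoint P \<longleftrightarrow>
     linear_op P \<and> densely_defined P \<and> op_adjoint P = P \<and>
     (\<forall>(x, y)\<in>P. cinner y x \<in> \<real> \<and> 0 \<le> Re (cinner y x))"

definition op_sqrt :: "('a::complex_hilbert \<times> 'a) set \<Rightarrow> ('a \<times> 'a) set" where
  "op_sqrt A = (THE P. positive_selfadjoint P \<and> P \<odot>\<^sub>o P = A)"

definition op_L :: "('h::complex_hilbert \<times> 'k::complex_hilbert) set \<Rightarrow>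
    ('h \<times> 'k) set \<Rightarrow> ('k \<times> 'h) set" where
  "op_L T S = op_sqrt (Id \<oplus>\<^sub>o op_adjoint T \<odot>\<^sub>o T) \<odot>\<^sub>o op_adjoint S
              \<ominus>\<^sub>o op_adjoint T \<odot>\<^sub>o op_sqrt (Id \<oplus>\<^sub>o S \<odot>\<^sub>o op_adjoint S)"

definition op_R :: "('h::complex_hilbert \<times> 'k::complex_hilbert) set \<Rightarrow>
    ('h \<times> 'k) set \<Rightarrow> ('k \<times> 'k) set" where
  "op_R S T = op_sqrt (Id \<oplus>\<^sub>o T \<odot>\<^sub>o op_adjoint T) \<odot>\<^sub>o op_sqrt (Id \<oplus>\<^sub>o S \<odot>\<^sub>o op_adjoint S)
              \<ominus>\<^sub>o T \<odot>\<^sub>o op_adjoint S"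

definition op_hat :: "('h::complex_hilbert \<times> 'k::complex_hilbert) set \<Rightarrow> ('k \<times> 'h) set" where
  "op_hat T = (op_sqrt (Id \<oplus>\<^sub>o op_adjoint T \<odot>\<^sub>o T))\<inverse> \<odot>\<^sub>o op_adjoint T"

text \<open>
  Bounded complex-linear operators are the complex-linear elements of the type of
  bounded real-linear operators, whose norm is the operator norm.
\<close>

definition graph_of :: "('a::real_normed_vector \<Rightarrow>\<^sub>L 'b::real_normed_vector) \<Rightarrow> ('a \<times> 'b) set" where
  "graph_of A = {(x, blinfun_apply A x) | x. True}"

definition bounded_op :: "('a::real_normed_vector \<times> 'b::real_normed_vector) set \<Rightarrow> 'a \<Rightarrow>\<^sub>L 'b" where
  "bounded_op G = (THE A. graph_of A = G)"

definition op_unit_ball :: "('k::complex_inner \<Rightarrow>\<^sub>L 'h::complex_inner) set" where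
  "op_unit_ball =
     {A. (\<forall>c x. blinfun_apply A (c *\<^sub>C x) = c *\<^sub>C blinfun_apply A x) \<and> norm A < 1}"

definition op_dist :: "('h::complex_hilbert \<times> 'k::complex_hilbert) set \<Rightarrow>
    ('h \<times> 'k) set \<Rightarrow> real" where
  "op_dist T S = artanh (norm (bounded_op (op_L T S \<odot>\<^sub>o (op_R S T)\<inverse>)))"

definition poincare_dist :: "complex \<Rightarrow> complex \<Rightarrow> real" where
  "poincare_dist a b = artanh (cmod (a - b) / cmod (1 - cnj a * b))"

text \<open>
  Holomorphy is complex Frechet differentiability: the real derivative exists
  and is complex-linear.
\<close>

definition holomorphic_disc_map ::
    "(complex \<Rightarrow> 'k::complex_inner \<Rightarrow>\<^sub>L 'h::complex_inner) \<Rightarrow> ('k \<Rightarrow>\<^sub>L 'h) set \<Rightarrow> bool" where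
  "holomorphic_disc_map f D \<longleftrightarrow>
     (\<forall>z\<in>ball 0 1. f z \<in> D \<and>
        (\<exists>f'. (f has_derivative f') (at z) \<and>
              (\<forall>c w x. blinfun_apply (f' (c * w)) x = c *\<^sub>C blinfun_apply (f' w) x)))"

definition analytic_chain ::
    "('k::complex_inner \<Rightarrow>\<^sub>L 'h::complex_inner) set \<Rightarrow> 'k \<Rightarrow>\<^sub>L 'h \<Rightarrow> 'k \<Rightarrow>\<^sub>L 'h \<Rightarrow> nat \<Rightarrow>
     (nat \<Rightarrow> complex) \<Rightarrow> (nat \<Rightarrow> complex) \<Rightarrow> (nat \<Rightarrow> complex \<Rightarrow> 'k \<Rightarrow>\<^sub>L 'h) \<Rightarrow> bool" where
  "analytic_chain D x y n z' z'' f \<longleftrightarrow>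
     1 \<le> n \<and>
     (\<forall>k\<in>{1..n}. z' k \<in> ball 0 1 \<and> z'' k \<in> ball 0 1 \<and> holomorphic_disc_map (f k) D) \<and>
     f 1 (z' 1) = x \<and>
     (\<forall>k\<in>{1..<n}. f k (z'' k) = f (Suc k) (z' (Suc k))) \<and>
     f n (z'' n) = y"

text \<open>The infimum is taken in the extended reals, so that it is \<open>\<infinity>\<close> if there is no chain.\<close>

definition kobayashi ::
    "('k::complex_inner \<Rightarrow>\<^sub>L 'h::complex_inner) set \<Rightarrow> 'k \<Rightarrow>\<^sub>L 'h \<Rightarrow> 'k \<Rightarrow>\<^sub>L 'h \<Rightarrow> ereal" where
  "kobayashi D x y =
     Inf {ereal (\<Sum>k=1..n. poincare_dist (z' k) (z'' k)) | n z' z'' f.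
            analytic_chain D x y n z' z'' f}"

end

theory Submission
  imports Defs "HOL-Complex_Analysis.Riemann_Mapping"
begin

text \<open>
  Since \<open>K\<close> is finite-dimensional, the operators in question are bounded. The operator matrix with rows
  \<open>((I + T*T)\<^sup>1\<^sup>/\<^sup>2, -T*)\<close> and \<open>(-T, (I + TT*)\<^sup>1\<^sup>/\<^sup>2)\<close> acts on the ball of \<open>B(K,H)\<close> by an invertible
  linear fractional map \<open>g\<close> that sends the transform of \<open>T\<close> to \<open>0\<close> and the transform of \<open>S\<close> to
  \<open>L\<^sub>T(S) R\<^sub>S(T)\<^sup>-\<^sup>1\<close>. Pulling back the complex line through \<open>0\<close> and \<open>L\<^sub>T(S) R\<^sub>S(T)\<^sup>-\<^sup>1\<close> gives a disc
  that bounds the Kobayashi distance from above by \<open>d(T,S)\<close>. The functions \<open>y \<mapsto> \<langle>g(y) u, v\<rangle>\<close> map the ball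
  into the disc, so by Schwarz-Pick they bound the length of every chain from below, and their supremum is
  again \<open>d(T,S)\<close>. The same two facts give symmetry and the triangle inequality.
\<close>

\<comment> \<open>The formula for \<open>op_dist T S\<close> is not visibly symmetric and the map
  \<open>g\<close> changes with \<open>T\<close>, so the metric axioms cannot be read off from it.
  The supremum over functions into the disc no longer refers to \<open>g\<close>, treats both
  operators alike, and inherits symmetry and the triangle inequality from
  \<open>poincare_dist\<close>. Definiteness holds because \<open>g\<close> vanishes only at the
  transform of \<open>T\<close> and this transform determines \<open>T\<close>. Finite dimension of
  \<open>K\<close> enters through compactness of its unit ball, which bounds a closed operator;
  closedness and the dense domain then make it everywhere defined. \<open>H\<close> may be
  infinite-dimensional, so inverses and square roots are obtained as fixed points of contractions.
  The type of bounded operators is only real-linear: the operator theory uses the real inner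
  product, and complex-linearity is carried along as \<open>clin\<close>. Square roots enter as
  definite descriptions over possibly unbounded operators, so uniqueness has to be proved in that
  larger class.\<close>
subclass (in complex_hilbert) banach ..

section \<open>Bounded operators on real Hilbert spaces\<close>

lemma norm_sq_add: "(norm (x + y))\<^sup>2 = (norm x)\<^sup>2 + 2 * inner x y + (norm y)\<^sup>2"
  for x y :: "'a::real_inner"
  by (simp add: power2_norm_eq_inner inner_simps inner_commute)

lemma norm_sq_diff: "(norm (x - y))\<^sup>2 = (norm x)\<^sup>2 - 2 * inner x y + (norm y)\<^sup>2"
  for x y :: "'a::real_inner"
  by (simp add: power2_norm_eq_inner inner_simps inner_commute)

text \<open>The representing vector minimises \<open>\<parallel>x\<parallel>\<^sup>2 - 2 \<phi> x\<close>; minimising sequences are Cauchy by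
  the parallelogram law.\<close>

lemma riesz_representation:
  fixes \<phi> :: "'a::{real_inner,banach} \<Rightarrow> real"
  assumes "bounded_linear \<phi>"
  shows "\<exists>y. \<forall>x. \<phi> x = inner x y"
proof -
  interpret bounded_linear \<phi> by fact
  define J where "J x = (norm x)\<^sup>2 - 2 * \<phi> x" for x
  obtain M where M: "\<And>x. norm (\<phi> x) \<le> norm x * M"
    using bounded by blast
  have J_ge: "- M\<^sup>2 \<le> J x" for x
  proof -
    have "\<phi> x \<le> norm x * M"
      using M[of x] by simp
    moreover have "0 \<le> (norm x - M)\<^sup>2"
      by simp
    ultimately show ?thesis
      by (simp add: J_def power2_diff)
  qed
  define m where "m = Inf (range J)"
  have bdd: "bdd_below (range J)"
    using J_ge by (auto intro!: bdd_belowI2)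
  have m_le: "m \<le> J x" for x
    unfolding m_def using bdd by (auto intro: cInf_lower)
  have "\<exists>x. J x < m + 1 / real (Suc n)" for n
    using cInf_lessD[of "range J" "m + 1 / real (Suc n)"] by (auto simp: m_def)
  then obtain X where X: "\<And>n. J (X n) < m + 1 / real (Suc n)"
    by metis
  have para: "(norm (x - y))\<^sup>2 \<le> 2 * (J x - m) + 2 * (J y - m)" for x y
  proof -
    have "J ((1/2) *\<^sub>R (x + y)) = (J x + J y) / 2 - (norm (x - y))\<^sup>2 / 4"
      by (simp add: J_def scaleR add power_mult_distrib norm_sq_add norm_sq_diff power_divide field_simps)
    then show ?thesis
      using m_le[of "(1/2) *\<^sub>R (x + y)"] by argo
  qed
  have "Cauchy X"
  proof (rule metric_CauchyI)
    fix e :: real assume "0 < e"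
    then obtain N where N: "4 / e\<^sup>2 < real N"
      using reals_Archimedean2 by blast
    then have N0: "0 < real N"
      using \<open>0 < e\<close> by (smt (verit) zero_le_divide_iff zero_le_power2)
    have "dist (X i) (X j) < e" if "N \<le> i" "N \<le> j" for i j
    proof -
      have b: "J (X i) - m < 1 / real N" if "N \<le> i" for i
      proof -
        have "1 / real (Suc i) \<le> 1 / real N"
          using that N0 by (intro divide_left_mono) auto
        then show ?thesis
          using X[of i] by linarith
      qed
      have "(norm (X i - X j))\<^sup>2 < 4 / real N"
        using para[of "X i" "X j"] b[OF that(1)] b[OF that(2)] by simp
      also have "\<dots> < e\<^sup>2"
        using N N0 \<open>0 < e\<close> by (simp add: field_simps)
      finally show ?thesis
        using power2_less_imp_less[of "norm (X i - X j)" e] \<open>0 < e\<close> by (simp add: dist_norm)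
    qed
    then show "\<exists>M. \<forall>m\<ge>M. \<forall>n\<ge>M. dist (X m) (X n) < e"
      by blast
  qed
  then obtain y where y: "X \<longlonglongrightarrow> y"
    using Cauchy_convergent_iff convergent_def by blast
  have "(\<lambda>n. J (X n)) \<longlonglongrightarrow> J y"
    unfolding J_def by (intro tendsto_intros y tendsto)
  moreover have "(\<lambda>n. m + 1 / real (Suc n)) \<longlonglongrightarrow> m + 0"
    using LIMSEQ_inverse_real_of_nat
    by (intro tendsto_add tendsto_const) (simp add: inverse_eq_divide)
  ultimately have Jy: "J y \<le> m"
    using LIMSEQ_le[of "\<lambda>n. J (X n)" "J y" "\<lambda>n. m + 1 / real (Suc n)" m] X less_imp_le by auto
  have "\<phi> v = inner v y" for v
  proof (rule ccontr)
    assume ne: "\<phi> v \<noteq> inner v y"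
    define d where "d = \<phi> v - inner v y"
    \<comment> \<open>The minimiser of \<open>J\<close> on the line is
      \<open>d / (norm v)\<^sup>2\<close>; the added 1 avoids a zero denominator and still gives a
      strict decrease.\<close>
    define s where "s = d / ((norm v)\<^sup>2 + 1)"
    have pos: "0 < (norm v)\<^sup>2 + 1"
      by (smt (verit) zero_le_power2)
    have "J (y + s *\<^sub>R v) = J y + s\<^sup>2 * (norm v)\<^sup>2 - 2 * s * d"
      by (simp add: J_def norm_sq_add add scaleR d_def power_mult_distrib inner_commute algebra_simps)
    moreover have "s\<^sup>2 * (norm v)\<^sup>2 - 2 * s * d = - (s\<^sup>2 * ((norm v)\<^sup>2 + 2))"
    proof -
      have "d = s * ((norm v)\<^sup>2 + 1)"
        using pos by (simp add: s_def)
      then show ?thesis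
        by (simp add: power2_eq_square algebra_simps)
    qed
    moreover have "0 < s\<^sup>2 * ((norm v)\<^sup>2 + 2)"
      using ne pos by (intro mult_pos_pos) (auto simp: s_def d_def)
    ultimately show False
      using m_le[of "y + s *\<^sub>R v"] Jy by linarith
  qed
  then show ?thesis
    by blast
qed

lemma adjoint_exists:
  fixes A :: "'a::{real_inner,banach} \<Rightarrow>\<^sub>L 'b::real_inner"
  shows "\<exists>B :: 'b \<Rightarrow>\<^sub>L 'a. \<forall>x y. inner (A x) y = inner x (B y)"
proof -
  have "\<exists>z. \<forall>x. inner (A x) y = inner x z" for y
    by (rule riesz_representation) (intro bounded_linear_intros)
  then obtain B where B: "\<And>x y. inner (A x) y = inner x (B y)"
    by metis
  have "bounded_linear B"
  proof (rule bounded_linear_intro)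
    show "B (x + y) = B x + B y" for x y
      by (rule vector_eq_ldot[THEN iffD1]) (simp add: inner_add_right flip: B)
    show "B (r *\<^sub>R x) = r *\<^sub>R B x" for r x
      by (rule vector_eq_ldot[THEN iffD1]) (simp flip: B)
    show "norm (B y) \<le> norm y * norm A" for y
    proof -
      have "norm (B y) * norm (B y) = inner (A (B y)) y"
        by (simp add: B power2_norm_eq_inner flip: power2_eq_square)
      also have "\<dots> \<le> norm (A (B y)) * norm y"
        by (rule norm_cauchy_schwarz)
      also have "\<dots> \<le> (norm A * norm (B y)) * norm y"
        by (intro mult_right_mono norm_blinfun) auto
      finally have "norm (B y) * norm (B y) \<le> norm (B y) * (norm y * norm A)"
        by (simp add: mult_ac)
      then show ?thesis
        by (cases "norm (B y) = 0") (auto simp: mult_le_cancel_left_pos)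
    qed
  qed
  then show ?thesis
    using B by (intro exI[of _ "Blinfun B"]) (simp add: bounded_linear_Blinfun_apply)
qed

definition adj :: "('a::{real_inner,banach} \<Rightarrow>\<^sub>L 'b::real_inner) \<Rightarrow> 'b \<Rightarrow>\<^sub>L 'a" where
  "adj A = (SOME B :: 'b \<Rightarrow>\<^sub>L 'a. \<forall>x y. inner (A x) y = inner x (B y))"

lemma adj:
  fixes A :: "'a::{real_inner,banach} \<Rightarrow>\<^sub>L 'b::real_inner"
  shows "inner (A x) y = inner x (adj A y)"
  using someI_ex[OF adjoint_exists[of A]] unfolding adj_def by blast

section \<open>Inverses of bounded operators\<close>

definition inverse_ops :: "('a::real_normed_vector \<Rightarrow>\<^sub>L 'b::real_normed_vector) \<Rightarrow> ('b \<Rightarrow>\<^sub>L 'a) \<Rightarrow> bool" where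
  "inverse_ops A B \<longleftrightarrow> (\<forall>x. A (B x) = x) \<and> (\<forall>x. B (A x) = x)"

lemmas compose_diff_left = bounded_bilinear.diff_left[OF bounded_bilinear_blinfun_compose]
  and compose_diff_right = bounded_bilinear.diff_right[OF bounded_bilinear_blinfun_compose]

text \<open>Fixed points of the contractions \<open>B \<mapsto> I + A B\<close> and
  \<open>B \<mapsto> I + B A\<close> are a right and a left inverse, hence equal. The norm bound
  follows by taking norms in \<open>B = I + A B\<close>.\<close>

lemma neumann_inverse:
  fixes A :: "'a::banach \<Rightarrow>\<^sub>L 'a"
  assumes "norm A < 1"
  shows "\<exists>B. inverse_ops (id_blinfun - A) B \<and> norm B \<le> 1 / (1 - norm A)"
proof -
  have "\<exists>!B. id_blinfun + (A o\<^sub>L B) = B"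
    using norm_blinfun_compose[of A]
    by (intro banach_fix_type[of "norm A"])
       (auto simp: assms dist_norm simp flip: compose_diff_right)
  then obtain B where B: "id_blinfun + (A o\<^sub>L B) = B"
    by blast
  have "\<exists>!B. id_blinfun + (B o\<^sub>L A) = B"
    using norm_blinfun_compose[of _ A]
    by (intro banach_fix_type[of "norm A"])
       (auto simp: assms dist_norm mult.commute[of "norm A"] simp flip: compose_diff_left)
  then obtain B' where B': "id_blinfun + (B' o\<^sub>L A) = B'"
    by blast
  have 1: "B x = x + A (B x)" for x
    using arg_cong[OF B, of "\<lambda>F. blinfun_apply F x"] by (simp add: blinfun.add_left)
  have 2: "B' x = x + B' (A x)" for x
    using arg_cong[OF B', of "\<lambda>F. blinfun_apply F x"] by (simp add: blinfun.add_left)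
  have eq: "B x = B' x" for x
  proof -
    have "B' (B x) = B' x + B' (A (B x))"
      by (subst 1) (simp add: blinfun.add_right)
    moreover have "B' (B x) = B x + B' (A (B x))"
      by (rule 2)
    ultimately show ?thesis
      by simp
  qed
  have "norm B \<le> norm (id_blinfun :: 'a \<Rightarrow>\<^sub>L 'a) + norm (A o\<^sub>L B)"
    using norm_triangle_ineq[of id_blinfun "A o\<^sub>L B"] unfolding B .
  also have "\<dots> \<le> 1 + norm A * norm B"
    by (intro add_mono norm_blinfun_id_le norm_blinfun_compose)
  finally have "norm B \<le> 1 / (1 - norm A)"
    using assms by (simp add: field_simps)
  moreover have "inverse_ops (id_blinfun - A) B"
  proof -
    have "B x - A (B x) = x" "B x - B (A x) = x" for x
      using 1[of x] 2[of x] eq[of x] eq[of "A x"] by (simp_all add: diff_eq_eq)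
    then show ?thesis
      by (simp add: inverse_ops_def blinfun.diff_left blinfun.diff_right)
  qed
  ultimately show ?thesis
    by blast
qed

text \<open>Admitting negative \<open>s\<close> lets callers pass constants such as
  \<open>1 - s * c\<close> without a sign check; \<open>max s 0\<close> repairs the square
  root.\<close>

lemma norm_blinfun_less_1:
  fixes A :: "'a::real_normed_vector \<Rightarrow>\<^sub>L 'b::real_normed_vector"
  assumes "s < 1" "\<And>x. (norm (A x))\<^sup>2 \<le> s * (norm x)\<^sup>2"
  shows "norm A < 1"
proof -
  have "norm A \<le> sqrt (max s 0)"
  proof (rule norm_blinfun_bound)
    fix x
    have "(norm (A x))\<^sup>2 \<le> max s 0 * (norm x)\<^sup>2"
      by (rule order_trans[OF assms(2)]) (intro mult_right_mono, auto)
    then have "norm (A x) \<le> sqrt (max s 0 * (norm x)\<^sup>2)"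
      by (rule real_le_rsqrt)
    then show "norm (A x) \<le> sqrt (max s 0) * norm x"
      by (simp add: real_sqrt_mult)
  qed simp
  also have "\<dots> < 1"
    using assms(1) by simp
  finally show ?thesis .
qed

text \<open>In the expansion of the squared norm of \<open>x - s A x\<close>, the choice
  \<open>s = c / M\<close> with \<open>M\<close> above \<open>(norm A)\<^sup>2\<close> lets half of
  the linear term absorb the quadratic one.\<close>

lemma coercive_contraction:
  fixes A :: "'a::real_inner \<Rightarrow>\<^sub>L 'a"
  assumes "0 < c" and ge: "\<And>x. c * (norm x)\<^sup>2 \<le> inner (A x) x"
  shows "\<exists>s>0. norm (id_blinfun - s *\<^sub>R A) < 1"
proof -
  define M where "M = (norm A)\<^sup>2 + 1"
  have M: "1 \<le> M"
    by (simp add: M_def)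
  define s where "s = c / M"
  have s: "0 < s"
    using M \<open>0 < c\<close> by (simp add: s_def)
  have "norm (id_blinfun - s *\<^sub>R A) < 1"
  proof (rule norm_blinfun_less_1)
    show "1 - s * c < 1"
      using s \<open>0 < c\<close> by simp
    fix x
    have "(norm (A x))\<^sup>2 \<le> (norm A * norm x)\<^sup>2"
      by (intro power_mono norm_blinfun) simp
    also have "\<dots> \<le> M * (norm x)\<^sup>2"
      by (simp add: M_def power_mult_distrib algebra_simps)
    finally have "s\<^sup>2 * (norm (A x))\<^sup>2 \<le> s\<^sup>2 * (M * (norm x)\<^sup>2)"
      by (intro mult_left_mono) auto
    also have "s\<^sup>2 * (M * (norm x)\<^sup>2) = s * (c * (norm x)\<^sup>2)"
      using M by (simp add: s_def power2_eq_square)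
    finally have 1: "s\<^sup>2 * (norm (A x))\<^sup>2 \<le> s * (c * (norm x)\<^sup>2)" .
    have 2: "s * (c * (norm x)\<^sup>2) \<le> s * inner x (A x)"
      using ge[of x] s by (intro mult_left_mono) (auto simp: inner_commute)
    have "(norm x)\<^sup>2 - 2 * (s * inner x (A x)) + s\<^sup>2 * (norm (A x))\<^sup>2 \<le> (1 - s * c) * (norm x)\<^sup>2"
      using 1 2 by (simp add: algebra_simps)
    then show "(norm ((id_blinfun - s *\<^sub>R A) x))\<^sup>2 \<le> (1 - s * c) * (norm x)\<^sup>2"
      by (simp add: blinfun.diff_left blinfun.scaleR_left norm_sq_diff power_mult_distrib)
  qed
  then show ?thesis
    using s by blast
qed

text \<open>Lax-Milgram: for suitable \<open>s\<close> the operator \<open>s A\<close> is a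
  perturbation of the identity of norm below 1.\<close>

lemma coercive_inverse:
  fixes A :: "'a::{real_inner,banach} \<Rightarrow>\<^sub>L 'a"
  assumes "0 < c" "\<And>x. c * (norm x)\<^sup>2 \<le> inner (A x) x"
  shows "\<exists>B. inverse_ops A B"
proof -
  obtain s where s: "0 < s" "norm (id_blinfun - s *\<^sub>R A) < 1"
    using coercive_contraction[OF assms] by blast
  obtain B where "inverse_ops (s *\<^sub>R A) B"
    using neumann_inverse[OF s(2)] by auto
  then have "inverse_ops A (s *\<^sub>R B)"
    using s(1) by (simp add: inverse_ops_def blinfun.scaleR_left blinfun.scaleR_right)
  then show ?thesis ..
qed

section \<open>Square roots of positive operators\<close>

definition selfadj :: "('a::real_inner \<Rightarrow>\<^sub>L 'a) \<Rightarrow> bool" where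
  "selfadj A \<longleftrightarrow> (\<forall>x y. inner (A x) y = inner x (A y))"

text \<open>After scaling, \<open>A = c (I - E)\<close> with \<open>\<parallel>E\<parallel> < 1\<close>, and \<open>I - Y\<close> squares to \<open>I - E\<close> iff \<open>Y\<close> is a
  fixed point of \<open>Y \<mapsto> (E + Y\<^sup>2) / 2\<close>, which is a contraction of the ball of radius \<open>\<parallel>E\<parallel>\<close>.\<close>

lemma sqrt_exists:
  fixes A :: "'a::{real_inner,banach} \<Rightarrow>\<^sub>L 'a"
  assumes sa: "selfadj A" and ge: "\<And>x. (norm x)\<^sup>2 \<le> inner (A x) x"
  shows "\<exists>R. selfadj R \<and> (\<exists>c>0. \<forall>x. c * (norm x)\<^sup>2 \<le> inner (R x) x) \<and> (\<forall>x. R (R x) = A x) \<and>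
     (\<forall>Z::'a \<Rightarrow>\<^sub>L 'a. (\<forall>x. Z (A x) = A (Z x)) \<longrightarrow> (\<forall>x. Z (R x) = R (Z x)))"
proof -
  obtain s where s: "0 < s" "norm (id_blinfun - s *\<^sub>R A) < 1"
    using coercive_contraction[of 1 A] ge by auto
  define c where "c = 1 / s"
  have c: "0 < c" "s = 1 / c"
    using s by (simp_all add: c_def)
  define E where "E = id_blinfun - s *\<^sub>R A"
  have e1: "norm E < 1"
    using s by (simp add: E_def)
  have E: "E x = x - (1 / c) *\<^sub>R A x" for x
    by (simp add: E_def c(2) blinfun.diff_left blinfun.scaleR_left)
  define \<Phi> where "\<Phi> Y = (1/2) *\<^sub>R (E + (Y o\<^sub>L Y))" for Y :: "'a \<Rightarrow>\<^sub>L 'a"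
  have \<Phi>: "\<Phi> Y x = (1/2) *\<^sub>R (E x + Y (Y x))" for Y x
    by (simp add: \<Phi>_def blinfun.add_left blinfun.scaleR_left)
  \<comment> \<open>Symmetry and commutation with the commutant of \<open>E\<close> are closed
    conditions, so building them into \<open>S\<close> passes them to the fixed point. The
    commutation later gives uniqueness and complex-linearity of the root.\<close>
  define S where "S = cball 0 (norm E) \<inter> {Y :: 'a \<Rightarrow>\<^sub>L 'a. \<forall>x y. inner (Y x) y = inner x (Y y)} \<inter>
     {Y :: 'a \<Rightarrow>\<^sub>L 'a. \<forall>Z::'a \<Rightarrow>\<^sub>L 'a. (\<forall>x. Z (E x) = E (Z x)) \<longrightarrow> (\<forall>x. Z (Y x) = Y (Z x))}"
  have "closed S"
    unfolding S_def
    by (intro closed_Int closed_cball closed_Collect_all closed_Collect_imp open_Collect_const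
        closed_Collect_eq continuous_intros)
  then have "complete S"
    by (simp add: complete_eq_closed)
  moreover have "0 \<in> S"
    by (simp add: S_def)
  then have "S \<noteq> {}"
    by blast
  moreover have "\<Phi> ` S \<subseteq> S"
  proof
    fix X assume "X \<in> \<Phi> ` S"
    then obtain Y where Y: "Y \<in> S" and X: "X = \<Phi> Y"
      by blast
    have Yn: "norm Y \<le> norm E" and Ysa: "\<And>x y. inner (Y x) y = inner x (Y y)"
      and Yc: "\<And>(Z :: 'a \<Rightarrow>\<^sub>L 'a) x. (\<And>x. Z (E x) = E (Z x)) \<Longrightarrow> Z (Y x) = Y (Z x)"
      using Y by (auto simp: S_def)
    have "norm X \<le> (norm E + norm Y * norm Y) / 2"
      using norm_triangle_ineq[of E "Y o\<^sub>L Y"] norm_blinfun_compose[of Y Y]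
      by (simp add: X \<Phi>_def)
    also have "norm Y * norm Y \<le> norm E * 1"
      using Yn e1 by (intro mult_mono) auto
    finally have "norm X \<le> norm E"
      by simp
    moreover have "inner (X x) y = inner x (X y)" for x y
    proof -
      have "inner (E x) y = inner x (E y)"
        using sa by (simp add: E inner_diff_left inner_diff_right selfadj_def)
      then show ?thesis
        by (simp add: X \<Phi> inner_add_left inner_add_right Ysa)
    qed
    moreover have "Z (X x) = X (Z x)" if "\<And>x. Z (E x) = E (Z x)" for Z :: "'a \<Rightarrow>\<^sub>L 'a" and x
      using that Yc[of Z] by (simp add: X \<Phi> blinfun.scaleR_right blinfun.add_right)
    ultimately show "X \<in> S"
      by (simp add: S_def)
  qed
  moreover have "dist (\<Phi> Y) (\<Phi> Z) \<le> norm E * dist Y Z" if "Y \<in> S \<and> Z \<in> S" for Y Z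
  proof -
    have n: "norm Y \<le> norm E" "norm Z \<le> norm E"
      using that by (auto simp: S_def)
    \<comment> \<open>This splitting of the difference of squares is valid without \<open>Y\<close>
      and \<open>Z\<close> commuting.\<close>
    have "\<Phi> Y - \<Phi> Z = (1/2) *\<^sub>R ((Y o\<^sub>L (Y - Z)) + ((Y - Z) o\<^sub>L Z))"
      by (simp add: \<Phi>_def compose_diff_left compose_diff_right scaleR_diff_right
          scaleR_add_right)
    then have "norm (\<Phi> Y - \<Phi> Z) \<le> (norm (Y o\<^sub>L (Y - Z)) + norm ((Y - Z) o\<^sub>L Z)) / 2"
      using norm_triangle_ineq by auto
    also have "\<dots> \<le> (norm E * norm (Y - Z) + norm (Y - Z) * norm E) / 2"
      by (intro divide_right_mono add_mono order_trans[OF norm_blinfun_compose] mult_mono n) auto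
    finally show ?thesis
      by (simp add: dist_norm mult.commute)
  qed
  ultimately obtain Y where Y: "Y \<in> S" "\<Phi> Y = Y"
    using Banach_fix[of S "norm E" \<Phi>] e1 by auto
  have Yn: "norm Y \<le> norm E" and Ysa: "\<And>x y. inner (Y x) y = inner x (Y y)"
    and Yc: "\<And>(Z :: 'a \<Rightarrow>\<^sub>L 'a) x. (\<And>x. Z (E x) = E (Z x)) \<Longrightarrow> Z (Y x) = Y (Z x)"
    using Y by (auto simp: S_def)
  define R where "R = sqrt c *\<^sub>R (id_blinfun - Y)"
  have R: "R x = sqrt c *\<^sub>R (x - Y x)" for x
    by (simp add: R_def blinfun.diff_left blinfun.scaleR_left)
  have "selfadj R"
    by (simp add: selfadj_def R inner_diff_left inner_diff_right Ysa)
  moreover have "sqrt c * (1 - norm E) * (norm x)\<^sup>2 \<le> inner (R x) x" for x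
  proof -
    have "inner (Y x) x \<le> norm (Y x) * norm x"
      by (rule norm_cauchy_schwarz)
    also have "\<dots> \<le> norm E * norm x * norm x"
      by (intro mult_right_mono order_trans[OF norm_blinfun[of Y x]] Yn) auto
    finally have "(1 - norm E) * (norm x)\<^sup>2 \<le> inner (x - Y x) x"
      by (simp add: inner_diff_left power2_norm_eq_inner[symmetric] power2_eq_square algebra_simps)
    then show ?thesis
      using c by (simp add: R mult.assoc)
  qed
  moreover have "0 < sqrt c * (1 - norm E)"
    using c e1 by simp
  moreover have "R (R x) = A x" for x
  proof -
    have "Y x + Y x = E x + Y (Y x)"
      using \<Phi>[of Y x] Y(2) by (simp add: scaleR_2[symmetric] del: scaleR_scaleR)
       (metis scaleR_half_double scaleR_right_distrib scaleR_2)
    then have "Y (Y x) = Y x + Y x - E x"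
      by (simp add: algebra_simps)
    then have "x - Y x - (Y x - Y (Y x)) = (1 / c) *\<^sub>R A x"
      by (simp add: E)
    then have "(sqrt c * sqrt c) *\<^sub>R (x - Y x - (Y x - Y (Y x))) = A x"
      using c by simp
    then show ?thesis
      by (simp add: R blinfun.scaleR_right blinfun.diff_right scaleR_diff_right)
  qed
  moreover have "Z (R x) = R (Z x)" if "\<And>x. Z (A x) = A (Z x)" for Z :: "'a \<Rightarrow>\<^sub>L 'a" and x
  proof -
    have "Z (Y x) = Y (Z x)"
      by (rule Yc) (simp add: E blinfun.diff_right blinfun.scaleR_right that)
    then show ?thesis
      by (simp add: R blinfun.diff_right blinfun.scaleR_right)
  qed
  ultimately show ?thesis
    by blast
qed

text \<open>\<open>P\<close> commutes with its square \<open>A\<close>, hence with \<open>R\<close>,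
  so \<open>(P + R) (P - R) = 0\<close>. Pairing with \<open>y = (P - R) x\<close> and using
  coercivity of \<open>R\<close> forces \<open>y = 0\<close>.\<close>

lemma sqrt_unique:
  fixes A R P :: "'a::real_inner \<Rightarrow>\<^sub>L 'a"
  assumes R: "0 < c" "\<And>x. c * (norm x)\<^sup>2 \<le> inner (R x) x" "\<And>x. R (R x) = A x"
    and comm: "\<And>Z::'a \<Rightarrow>\<^sub>L 'a. (\<And>x. Z (A x) = A (Z x)) \<Longrightarrow> (\<And>x. Z (R x) = R (Z x))"
    and P: "\<And>x. 0 \<le> inner (P x) x" "\<And>x. P (P x) = A x"
  shows "P = R"
proof (rule blinfun_eqI)
  fix x
  define y where "y = P x - R x"
  have "P (R x) = R (P x)"
    by (rule comm) (metis P(2))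
  then have "P y + R y = 0"
    by (simp add: y_def blinfun.diff_right P R)
  then have "inner (P y) y + inner (R y) y = 0"
    by (metis inner_add_left inner_zero_left)
  then have "c * (norm y)\<^sup>2 \<le> 0"
    using P(1)[of y] R(2)[of y] by linarith
  then have "y = 0"
    using R(1) by (simp add: mult_le_0_iff)
  then show "P x = R x"
    by (simp add: y_def)
qed

section \<open>The Poincare distance\<close>

lemma artanh_real_le_iff:
  fixes x y :: real
  assumes "0 \<le> x" "x < 1" "0 \<le> y" "y < 1"
  shows "artanh x \<le> artanh y \<longleftrightarrow> x \<le> y"
proof -
  have "(1 + x) / (1 - x) \<le> (1 + y) / (1 - y) \<longleftrightarrow> x \<le> y"
    using assms by (simp add: divide_simps) (simp add: algebra_simps)
  then show ?thesis
    using assms by (simp add: artanh_def)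
qed

lemma artanh_real_mono:
  fixes x y :: real
  assumes "0 \<le> x" "x \<le> y" "y < 1"
  shows "artanh x \<le> artanh y"
  using assms by (simp add: artanh_real_le_iff)

lemma artanh_real_nonneg: "0 \<le> artanh x" if "0 \<le> x" "x < 1" for x :: real
  using artanh_real_mono[of 0 x] that by simp

text \<open>The quotient \<open>(1 + t) / (1 - t)\<close> turns the addition formula into a
  product.\<close>

lemma artanh_real_add:
  fixes x y :: real
  assumes "0 \<le> x" "x < 1" "0 \<le> y" "y < 1"
  shows "artanh ((x + y) / (1 + x * y)) = artanh x + artanh y"
proof -
  have pos: "0 < 1 + x * y"
    using assms by (smt (verit) mult_nonneg_nonneg)
  have "(1 + (x + y) / (1 + x * y)) / (1 - (x + y) / (1 + x * y)) =
      ((1 + x * y) + (x + y)) / ((1 + x * y) - (x + y))"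
    using pos by (simp add: divide_simps)
  also have "\<dots> = ((1 + x) * (1 + y)) / ((1 - x) * (1 - y))"
    by (simp add: algebra_simps)
  also have "\<dots> = ((1 + x) / (1 - x)) * ((1 + y) / (1 - y))"
    by simp
  finally show ?thesis
    using assms ln_mult_pos[of "(1 + x) / (1 - x)" "(1 + y) / (1 - y)"]
    unfolding artanh_def by simp
qed

lemma poincare_dist_Moebius: "poincare_dist a b = artanh (cmod (Moebius_function 0 a b))"
  by (simp add: poincare_dist_def Moebius_function_simple norm_divide norm_minus_commute)

lemma poincare_dist_commute: "poincare_dist a b = poincare_dist b a"
proof -
  have "cmod (1 - cnj a * b) = cmod (cnj (1 - cnj a * b))"
    by (simp only: complex_mod_cnj)
  then show ?thesis
    by (simp add: poincare_dist_def norm_minus_commute mult.commute)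
qed

text \<open>Disc automorphisms move \<open>a\<close> and \<open>f a\<close> to 0; the Schwarz lemma
  is then applied at the image of \<open>b\<close>.\<close>

lemma schwarz_pick:
  assumes f: "f holomorphic_on ball 0 1" "f ` ball 0 1 \<subseteq> ball 0 1"
    and ab: "a \<in> ball 0 1" "b \<in> ball 0 1"
  shows "cmod (Moebius_function 0 (f a) (f b)) \<le> cmod (Moebius_function 0 a b)"
proof -
  have a: "cmod a < 1" "cmod (- a) < 1" and b: "cmod b < 1" and fa: "cmod (f a) < 1"
    using ab f(2) by (auto simp: image_subset_iff)
  define g where "g = Moebius_function 0 (f a) \<circ> (f \<circ> Moebius_function 0 (- a))"
  have im: "Moebius_function 0 (- a) ` ball 0 1 \<subseteq> ball 0 1"
    using Moebius_function_norm_lt_1[OF a(2)] by auto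
  have "g holomorphic_on ball 0 1"
    unfolding g_def
    by (rule holomorphic_on_compose_gen[where t = "ball 0 1"])
       (use im f in \<open>auto intro!: holomorphic_on_compose_gen[where t = "ball 0 1"]
          Moebius_function_holomorphic fa a(2) simp: image_subset_iff\<close>)
  moreover have "g 0 = 0"
    by (simp add: g_def Moebius_function_of_zero Moebius_function_eq_zero)
  moreover have "cmod (g z) < 1" if "cmod z < 1" for z
    using f(2) Moebius_function_norm_lt_1[OF a(2) that]
    by (auto simp: g_def image_subset_iff intro!: Moebius_function_norm_lt_1 fa)
  ultimately have "cmod (g (Moebius_function 0 a b)) \<le> cmod (Moebius_function 0 a b)"
    by (rule Schwarz_Lemma(1)) (use Moebius_function_norm_lt_1[OF a(1) b] in auto)
  moreover have "Moebius_function 0 (- a) (Moebius_function 0 a b) = b"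
    by (rule Moebius_function_compose) (use a b in auto)
  ultimately show ?thesis
    by (simp add: g_def)
qed

lemma poincare_dist_contracting:
  assumes "f holomorphic_on ball 0 1" "f ` ball 0 1 \<subseteq> ball 0 1"
    and "a \<in> ball 0 1" "b \<in> ball 0 1"
  shows "poincare_dist (f a) (f b) \<le> poincare_dist a b"
  unfolding poincare_dist_Moebius
  using schwarz_pick[OF assms] assms Moebius_function_norm_lt_1[of a b]
  by (intro artanh_real_mono) auto

text \<open>With \<open>K = (1 - x\<^sup>2) (1 - y\<^sup>2)\<close>, each squared denominator is the
  corresponding squared numerator plus \<open>K\<close>. Since \<open>t / (t + K)\<close> increases
  in \<open>t\<close>, comparing the numerators by the triangle inequality is enough.\<close>

lemma cmod_Moebius_le:
  assumes "cmod p < 1" "cmod q < 1"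
  shows "cmod (Moebius_function 0 p q) \<le> (cmod p + cmod q) / (1 + cmod p * cmod q)"
proof -
  define x y where "x = cmod p" and "y = cmod q"
  have xy: "0 \<le> x" "0 \<le> y" "x\<^sup>2 < 1" "y\<^sup>2 < 1"
    using assms by (auto simp: x_def y_def abs_square_less_1)
  define K where "K = (1 - x\<^sup>2) * (1 - y\<^sup>2)"
  have K: "0 < K"
    using xy by (simp add: K_def)
  have pos: "0 < 1 + x * y"
    using xy by (smt (verit) mult_nonneg_nonneg)
  have e: "(cmod (1 - cnj p * q))\<^sup>2 = (cmod (q - p))\<^sup>2 + K"
    unfolding K_def x_def y_def cmod_power2 by (simp add: power2_eq_square algebra_simps)
  then have pos': "0 < cmod (1 - cnj p * q)"
    using K by (smt (verit) zero_less_norm_iff norm_zero power_zero_numeral zero_le_power2)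
  have "(cmod (q - p))\<^sup>2 \<le> (x + y)\<^sup>2"
    using norm_triangle_ineq4[of q p] by (intro power_mono) (auto simp: x_def y_def)
  then have "(cmod (q - p))\<^sup>2 * K \<le> (x + y)\<^sup>2 * K"
    using K by (intro mult_right_mono) auto
  moreover have "(1 + x * y)\<^sup>2 = (x + y)\<^sup>2 + K"
    by (simp add: K_def power2_eq_square algebra_simps)
  ultimately have "(cmod (q - p))\<^sup>2 * (1 + x * y)\<^sup>2 \<le> (x + y)\<^sup>2 * (cmod (1 - cnj p * q))\<^sup>2"
    unfolding e by (simp add: algebra_simps)
  then have "cmod (q - p) * (1 + x * y) \<le> (x + y) * cmod (1 - cnj p * q)"
    using xy by (intro power2_le_imp_le[of "cmod (q - p) * _"]) (simp_all add: power_mult_distrib)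
  then show ?thesis
    using pos pos' by (simp add: Moebius_function_simple norm_divide x_def y_def field_simps)
qed

text \<open>Move \<open>b\<close> to 0, where the two distances on the right are
  \<open>artanh\<close> of moduli and add up by \<open>artanh_real_add\<close>. Schwarz-Pick for the
  map moving back gives the direction of invariance that is used.\<close>

lemma poincare_dist_triangle:
  assumes "a \<in> ball 0 1" "b \<in> ball 0 1" "c \<in> ball 0 1"
  shows "poincare_dist a c \<le> poincare_dist a b + poincare_dist b c"
proof -
  have n: "cmod a < 1" "cmod b < 1" "cmod (- b) < 1" "cmod c < 1"
    using assms by auto
  define p q where "p = Moebius_function 0 b a" and "q = Moebius_function 0 b c"
  have pq: "cmod p < 1" "cmod q < 1"
    unfolding p_def q_def by (auto intro!: Moebius_function_norm_lt_1 n)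
  have "poincare_dist (Moebius_function 0 (- b) p) (Moebius_function 0 (- b) q) \<le> poincare_dist p q"
    by (intro poincare_dist_contracting Moebius_function_holomorphic)
       (use n pq in \<open>auto intro!: Moebius_function_norm_lt_1\<close>)
  moreover have "Moebius_function 0 (- b) p = a" "Moebius_function 0 (- b) q = c"
    unfolding p_def q_def by (rule Moebius_function_compose; use n in simp)+
  ultimately have "poincare_dist a c \<le> artanh (cmod (Moebius_function 0 p q))"
    by (simp add: poincare_dist_Moebius)
  also have "\<dots> \<le> artanh ((cmod p + cmod q) / (1 + cmod p * cmod q))"
  proof (intro artanh_real_mono cmod_Moebius_le pq)
    have "0 < (1 - cmod p) * (1 - cmod q)"
      using pq by simp
    then have "cmod p + cmod q < 1 + cmod p * cmod q"
      by (simp add: algebra_simps)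
    then show "(cmod p + cmod q) / (1 + cmod p * cmod q) < 1"
      by (simp add: divide_less_eq add_pos_nonneg)
  qed simp
  also have "\<dots> = artanh (cmod p) + artanh (cmod q)"
    using pq by (intro artanh_real_add) auto
  finally show ?thesis
    using poincare_dist_commute[of a b] by (simp add: poincare_dist_Moebius p_def q_def)
qed

section \<open>Complex-linear operators\<close>

lemma cinner_scaleC_right: "cinner x (c *\<^sub>C y) = cnj c * cinner x y"
  by (metis cinner_commute cinner_scaleC_left complex_cnj_mult)

text \<open>Lifts identities from the real inner product, which sees only real parts, to the complex
  one.\<close>

lemma cinner_eqI:
  assumes "\<And>c. Re (c * a) = Re (c * b)"
  shows "a = b"
  using assms[of 1] assms[of \<i>] by (simp add: complex_eq_iff)

lemma cinner_self: "cinner x x = complex_of_real ((norm x)\<^sup>2)"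
proof -
  have "Im (cinner x x) = 0"
    using cinner_commute[of x x] by (simp add: complex_eq_iff)
  then show ?thesis
    by (simp add: complex_eq_iff power2_norm_eq_inner inner_eq_Re_cinner)
qed

lemma norm_scaleC: "norm (c *\<^sub>C x) = cmod c * norm x" for x :: "'a::complex_inner"
proof -
  have "complex_of_real ((norm (c *\<^sub>C x))\<^sup>2) = complex_of_real ((cmod c * norm x)\<^sup>2)"
  proof -
    have "cinner (c *\<^sub>C x) (c *\<^sub>C x) = (c * cnj c) * cinner x x"
      by (simp add: cinner_scaleC_left cinner_scaleC_right)
    then show ?thesis
      by (simp only: cinner_self complex_norm_square[symmetric] of_real_mult power_mult_distrib)
  qed
  then show ?thesis
    by (metis of_real_eq_iff norm_ge_zero zero_le_mult_iff power2_eq_imp_eq)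
qed

lemma scaleR_scaleC_commute: "r *\<^sub>R c *\<^sub>C x = c *\<^sub>C r *\<^sub>R x" for x :: "'a::complex_vector"
  by (simp add: scaleR_scaleC scaleC_scaleC mult.commute)

lemma scaleC_minus_right: "c *\<^sub>C (- x) = - (c *\<^sub>C x)" for x :: "'a::complex_vector"
  by (rule complex_vector.scale_minus_right)

lemma scaleC_diff_right: "c *\<^sub>C (x - y) = c *\<^sub>C x - c *\<^sub>C y" for x :: "'a::complex_vector"
  by (rule complex_vector.scale_right_diff_distrib)

lemma cinner_zero_left: "cinner 0 y = 0"
  using cinner_add_left[of 0 0 y] by simp

lemma norm_cinner_le: "cmod (cinner x y) \<le> norm x * norm y"
proof (cases "cinner x y = 0")
  case False
  \<comment> \<open>The phase that makes \<open>c * cinner x y\<close> real and nonnegative, so that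
    real Cauchy-Schwarz applies.\<close>
  define c where "c = cnj (cinner x y) / cmod (cinner x y)"
  have "cmod c = 1"
    using False by (simp add: c_def norm_divide)
  have "c * cinner x y = of_real (cmod (cinner x y))"
    using False by (simp add: c_def complex_norm_square[symmetric] power2_eq_square mult.commute)
  then have "cmod (cinner x y) = inner (c *\<^sub>C x) y"
    by (simp add: inner_eq_Re_cinner cinner_scaleC_left)
  also have "\<dots> \<le> norm (c *\<^sub>C x) * norm y"
    by (rule norm_cauchy_schwarz)
  finally show ?thesis
    by (simp add: norm_scaleC \<open>cmod c = 1\<close>)
qed simp

lemma bounded_linear_cinner_left: "bounded_linear (\<lambda>x. cinner x y)"
  by (rule bounded_linear_intro[of _ "norm y"])
     (simp_all add: cinner_add_left cinner_scaleC_left scaleR_scaleC norm_cinner_le scaleR_conv_of_real)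

lemma bounded_linear_scaleC_right: "bounded_linear ((\<lambda>x. c *\<^sub>C x) :: 'a \<Rightarrow> 'a::complex_inner)"
  by (rule bounded_linear_intro[of _ "cmod c"])
     (simp_all add: scaleC_add_right scaleR_scaleC_commute norm_scaleC mult.commute)

text \<open>Only the homogeneity that a bounded real-linear operator may lack; additivity comes with
  the operator type.\<close>

definition clin :: "('a::complex_vector \<Rightarrow> 'b::complex_vector) \<Rightarrow> bool" where
  "clin A \<longleftrightarrow> (\<forall>c x. A (c *\<^sub>C x) = c *\<^sub>C A x)"

lemma clinD: "clin A \<Longrightarrow> A (c *\<^sub>C x) = c *\<^sub>C A x"
  by (simp add: clin_def)

lemma clin_inverse_ops: "inverse_ops A B \<Longrightarrow> clin A \<Longrightarrow> clin B"
  unfolding inverse_ops_def clin_def by metis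

lemma cinner_adjoint:
  fixes A :: "'a::complex_inner \<Rightarrow> 'b::complex_inner"
  assumes "clin A" "\<And>x y. inner (A x) y = inner x (B y)"
  shows "cinner (A x) y = cinner x (B y)"
proof (rule cinner_eqI)
  fix c
  show "Re (c * cinner (A x) y) = Re (c * cinner x (B y))"
    using assms(2)[of "c *\<^sub>C x" y]
    by (simp add: inner_eq_Re_cinner clinD[OF assms(1)] cinner_scaleC_left)
qed

lemma clin_adjoint:
  fixes A :: "'a::complex_inner \<Rightarrow> 'b::complex_inner"
  assumes "clin A" "\<And>x y. inner (A x) y = inner x (B y)"
  shows "clin B"
  unfolding clin_def
proof (intro allI)
  fix c y
  show "B (c *\<^sub>C y) = c *\<^sub>C B y"
    by (rule vector_eq_ldot[THEN iffD1])
       (simp add: inner_eq_Re_cinner cinner_adjoint[OF assms, symmetric] cinner_scaleC_right)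
qed

text \<open>Multiplication by \<open>c\<close> is a bounded real-linear operator commuting with
  \<open>A\<close>, so it is an admissible \<open>Z\<close>.\<close>

lemma clin_commute_scaleC:
  fixes R :: "'a::complex_inner \<Rightarrow>\<^sub>L 'a"
  assumes "clin A" "\<And>Z::'a \<Rightarrow>\<^sub>L 'a. (\<And>x. Z (A x) = A (Z x)) \<Longrightarrow> (\<And>x. Z (R x) = R (Z x))"
  shows "clin R"
  unfolding clin_def
proof (intro allI)
  fix c x
  have Z: "blinfun_apply (Blinfun (\<lambda>x::'a. c *\<^sub>C x)) = (\<lambda>x. c *\<^sub>C x)"
    by (simp add: bounded_linear_Blinfun_apply bounded_linear_scaleC_right)
  show "R (c *\<^sub>C x) = c *\<^sub>C R x"
    using assms(2)[of "Blinfun (\<lambda>x. c *\<^sub>C x)" x] by (simp add: Z clinD[OF assms(1)])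
qed

text \<open>Used for operators known only through their composite with a surjection
  \<open>A\<close>. As \<open>A\<close> is bounded, the defect in terms of \<open>x\<close> becomes
  a fixed fraction of the squared norm of \<open>A x\<close>.\<close>

lemma norm_expansive:
  fixes A :: "'a::real_normed_vector \<Rightarrow>\<^sub>L 'b::real_normed_vector" and F :: "'b \<Rightarrow>\<^sub>L 'c::real_normed_vector"
  assumes surj: "\<And>y. \<exists>x. y = A x" and s: "0 < s"
    and F: "\<And>x. (norm (F (A x)))\<^sup>2 \<le> (norm (A x))\<^sup>2 - s * (norm x)\<^sup>2"
  shows "norm F < 1"
proof (rule norm_blinfun_less_1)
  define M where "M = norm A + 1"
  have M: "0 < M"
    by (simp add: M_def add_nonneg_pos)
  show "1 - s / M\<^sup>2 < 1"
    using s M by simp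
  fix y
  obtain x where y: "y = A x"
    using surj by blast
  have "norm y \<le> norm A * norm x"
    unfolding y by (rule norm_blinfun)
  also have "\<dots> \<le> M * norm x"
    by (simp add: M_def mult_right_mono)
  finally have "(norm y)\<^sup>2 \<le> M\<^sup>2 * (norm x)\<^sup>2"
    by (metis norm_ge_zero power_mono power_mult_distrib)
  then have "s / M\<^sup>2 * (norm y)\<^sup>2 \<le> s / M\<^sup>2 * (M\<^sup>2 * (norm x)\<^sup>2)"
    using s by (intro mult_left_mono) auto
  also have "\<dots> = s * (norm x)\<^sup>2"
    using M by simp
  finally show "(norm (F y))\<^sup>2 \<le> (1 - s / M\<^sup>2) * (norm y)\<^sup>2"
    using F[of x] y by (simp add: algebra_simps)
qed

section \<open>Linear fractional transformations of the operator ball\<close>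

text \<open>The operator matrix with rows \<open>(P, -T*)\<close> and \<open>(-T, Q)\<close>, where \<open>P = (I + T*T)\<^sup>1\<^sup>/\<^sup>2\<close> and
  \<open>Q = (I + TT*)\<^sup>1\<^sup>/\<^sup>2\<close>, preserves the indefinite form \<open>\<parallel>h\<parallel>\<^sup>2 - \<parallel>k\<parallel>\<^sup>2\<close> on \<open>H \<times> K\<close>. Its
  linear fractional action on the ball of \<open>B(K,H)\<close> sends \<open>(I + T*T)\<^sup>-\<^sup>1\<^sup>/\<^sup>2 T*\<close> to \<open>0\<close>; replacing
  \<open>T\<close> by \<open>-T\<close> inverts it.\<close>

locale ball_automorphism =
  fixes T :: "'h::complex_hilbert \<Rightarrow>\<^sub>L 'k::complex_hilbert" and T' :: "'k \<Rightarrow>\<^sub>L 'h"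
    and P P' :: "'h \<Rightarrow>\<^sub>L 'h" and Q Q' :: "'k \<Rightarrow>\<^sub>L 'k"
  assumes clin: "clin T" "clin T'" "clin P" "clin Q"
    and adjoint: "inner (T h) k = inner h (T' k)"
    and selfadj: "selfadj P" "selfadj Q"
    and PP: "P (P h) = h + T' (T h)"
    and QQ: "Q (Q k) = k + T (T' k)"
    and TP: "T (P h) = Q (T h)"
    and T'Q: "T' (Q k) = P (T' k)"
    and inverse: "inverse_ops P P'" "inverse_ops Q Q'"
begin

lemma ball_automorphism_uminus: "ball_automorphism (- T) (- T') P P' Q Q'"
  using clin adjoint selfadj PP QQ TP T'Q inverse
  by unfold_locales (auto simp: clin_def blinfun.minus_left blinfun.minus_right scaleC_minus_right)

lemma sa: "inner (P x) y = inner x (P y)" "inner (Q u) v = inner u (Q v)"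
  using selfadj by (auto simp: selfadj_def)

lemma inv: "P (P' h) = h" "P' (P h) = h" "Q (Q' k) = k" "Q' (Q k) = k"
  using inverse by (auto simp: inverse_ops_def)

lemma norm_T: "(norm (T h))\<^sup>2 = (norm (P h))\<^sup>2 - (norm h)\<^sup>2"
  by (simp add: power2_norm_eq_inner adjoint sa PP inner_add_right)

lemma norm_T': "(norm (T' k))\<^sup>2 = (norm (Q k))\<^sup>2 - (norm k)\<^sup>2"
  by (simp add: power2_norm_eq_inner adjoint[symmetric] sa QQ inner_add_right inner_commute)

lemma inner_PT': "inner (P h) (T' k) = inner (T h) (Q k)"
  by (metis adjoint sa(1) T'Q)

lemma inner_QQ: "inner (Q k) (Q l) = inner k l + inner (T' k) (T' l)"
proof -
  have "inner k (T (T' l)) = inner (T' k) (T' l)"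
    by (metis adjoint inner_commute)
  then show ?thesis
    by (simp add: sa QQ inner_add_right)
qed

text \<open>The cross terms on the two sides agree by \<open>inner_PT'\<close>; the squares are
  handled by \<open>norm_T\<close> and \<open>norm_T'\<close>.\<close>

lemma indefinite_form: "(norm (P h - T' k))\<^sup>2 + (norm k)\<^sup>2 = (norm (Q k - T h))\<^sup>2 + (norm h)\<^sup>2"
  by (simp add: norm_sq_diff norm_T norm_T' inner_PT' inner_commute)

definition den :: "('k \<Rightarrow>\<^sub>L 'h) \<Rightarrow> 'k \<Rightarrow>\<^sub>L 'k" where
  "den y = Q - (T o\<^sub>L y)"

text \<open>Choice makes \<open>iden\<close>, and with it \<open>frac\<close>, total; the value is
  meaningful on the open unit ball.\<close>

definition iden :: "('k \<Rightarrow>\<^sub>L 'h) \<Rightarrow> 'k \<Rightarrow>\<^sub>L 'k" where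
  "iden y = (SOME G. inverse_ops (den y) G)"

definition frac :: "('k \<Rightarrow>\<^sub>L 'h) \<Rightarrow> 'k \<Rightarrow>\<^sub>L 'h" where
  "frac y = ((P o\<^sub>L y) - T') o\<^sub>L iden y"

definition hat :: "'k \<Rightarrow>\<^sub>L 'h" where
  "hat = P' o\<^sub>L T'"

lemma den_apply: "den y k = Q k - T (y k)"
  by (simp add: den_def blinfun.diff_left)

lemma hat_Q: "hat (Q k) = T' k"
  by (simp add: hat_def T'Q inv)

lemma norm_hat: "norm hat < 1"
  by (rule norm_expansive[of Q 1]) (auto simp: hat_Q norm_T' intro: inv[symmetric])

lemma norm_Q'T: "norm (Q' o\<^sub>L T) < 1"
proof (rule norm_expansive[of P 1])
  show "\<exists>x. y = P x" for y
    by (metis inv(1))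
qed (auto simp: TP inv norm_T)

text \<open>Factor \<open>den y = Q (I - Q' T y)\<close>. The bound is uniform in \<open>y\<close>
  because \<open>norm (Q' o\<^sub>L T) < 1\<close>; this uniformity is what differentiating
  \<open>iden\<close> along a disc requires.\<close>

lemma iden_exists:
  assumes "norm y < 1"
  shows "\<exists>G. inverse_ops (den y) G \<and> norm G \<le> norm Q' / (1 - norm (Q' o\<^sub>L T))"
proof -
  define A where "A = (Q' o\<^sub>L T) o\<^sub>L y"
  have n: "norm A \<le> norm (Q' o\<^sub>L T)"
    unfolding A_def using assms
    by (intro order_trans[OF norm_blinfun_compose] mult_left_le) auto
  then obtain B where B: "inverse_ops (id_blinfun - A) B" "norm B \<le> 1 / (1 - norm A)"
    using neumann_inverse[of A] norm_Q'T by force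
  have "inverse_ops (den y) (B o\<^sub>L Q')"
    unfolding inverse_ops_def
  proof (intro conjI allI)
    fix k
    show "(B o\<^sub>L Q') (den y k) = k"
      using B(1) by (simp add: den_apply blinfun.diff_left blinfun.diff_right inv A_def inverse_ops_def)
    have "Q ((id_blinfun - A) (B (Q' k))) = k"
      using B(1) by (simp add: inverse_ops_def inv)
    then show "den y ((B o\<^sub>L Q') k) = k"
      by (simp add: den_apply blinfun.diff_left blinfun.diff_right inv A_def)
  qed
  moreover have "norm (B o\<^sub>L Q') \<le> 1 / (1 - norm (Q' o\<^sub>L T)) * norm Q'"
  proof (intro order_trans[OF norm_blinfun_compose] mult_right_mono order_trans[OF B(2)])
    show "1 / (1 - norm A) \<le> 1 / (1 - norm (Q' o\<^sub>L T))"
      using n norm_Q'T by (intro divide_left_mono) auto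
  qed simp
  ultimately show ?thesis
    by auto
qed

lemma inverse_ops_unique: "inverse_ops A B \<Longrightarrow> inverse_ops A C \<Longrightarrow> B = C"
  unfolding inverse_ops_def by (metis blinfun_eqI)

lemma iden: "norm y < 1 \<Longrightarrow> inverse_ops (den y) (iden y)"
  unfolding iden_def by (metis iden_exists someI)

lemma norm_iden: "norm y < 1 \<Longrightarrow> norm (iden y) \<le> norm Q' / (1 - norm (Q' o\<^sub>L T))"
  using iden_exists iden inverse_ops_unique by blast

lemma frac_den:
  assumes "norm y < 1"
  shows "frac y (den y k) = P (y k) - T' k"
  using iden[OF assms] by (simp add: frac_def inverse_ops_def blinfun.diff_left)

lemma den_surj: "norm y < 1 \<Longrightarrow> \<exists>k. m = den y k"
  using iden unfolding inverse_ops_def by metis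

text \<open>As \<open>den y\<close> is onto, this equation pins down \<open>frac y\<close>;
  identities of fractional maps are checked through it without manipulating inverses.\<close>

lemma frac_unique:
  fixes F :: "'k \<Rightarrow>\<^sub>L 'h"
  assumes "norm y < 1" "\<And>k. F (den y k) = P (y k) - T' k"
  shows "frac y = F"
  by (rule blinfun_eqI) (metis assms den_surj frac_den)

text \<open>Invariance of the form at the pair \<open>(y k, k)\<close> turns the gap between
  \<open>norm k\<close> and \<open>norm (y k)\<close> into one between \<open>den y k\<close> and
  its image.\<close>

lemma norm_frac:
  assumes "norm y < 1"
  shows "norm (frac y) < 1"
proof (rule norm_expansive[of "den y" "1 - (norm y)\<^sup>2"])
  show "\<exists>x. m = den y x" for m
    by (rule den_surj[OF assms])
  show "0 < 1 - (norm y)\<^sup>2"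
    using assms by (simp add: abs_square_less_1)
  fix k
  have "(norm (y k))\<^sup>2 \<le> (norm y)\<^sup>2 * (norm k)\<^sup>2"
    by (metis norm_blinfun norm_ge_zero power_mono power_mult_distrib)
  then show "(norm (frac y (den y k)))\<^sup>2 \<le> (norm (den y k))\<^sup>2 - (1 - (norm y)\<^sup>2) * (norm k)\<^sup>2"
    using indefinite_form[of "y k" k] unfolding frac_den[OF assms] by (simp add: den_apply algebra_simps)
qed

lemma clin_iden: "norm y < 1 \<Longrightarrow> clin (blinfun_apply y) \<Longrightarrow> clin (iden y)"
  by (rule clin_inverse_ops[OF iden]) (use clin in \<open>auto simp: clin_def den_apply scaleC_diff_right\<close>)

lemma clin_frac: "norm y < 1 \<Longrightarrow> clin (blinfun_apply y) \<Longrightarrow> clin (frac y)"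
  using clin_iden[of y] clin by (simp add: clin_def frac_def blinfun.diff_left scaleC_diff_right)

lemma clin_hat: "clin hat"
  using clin_inverse_ops[OF inverse(1)] clin by (simp add: hat_def clin_def)

lemma frac_hat: "frac hat = 0"
  by (rule frac_unique[OF norm_hat]) (simp add: hat_def inv)

lemma frac_eq_0:
  assumes "norm y < 1" "frac y = 0"
  shows "y = hat"
proof (rule blinfun_eqI)
  fix k
  have "P (y k) = T' k"
    using frac_den[OF assms(1), of k] assms(2) by simp
  then show "y k = hat k"
    by (metis hat_def blinfun_apply_blinfun_compose inv(2))
qed

interpretation neg: ball_automorphism "- T" "- T'" P P' Q Q'
  by (rule ball_automorphism_uminus)

text \<open>The matrix sends \<open>(y k, k)\<close> to the pair of numerator and denominator of
  \<open>frac y\<close> at \<open>k\<close>; the matrix of \<open>- T\<close> sends this pair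
  back.\<close>

lemma neg_frac_frac:
  assumes y: "norm y < 1"
  shows "neg.frac (frac y) = y"
proof (rule neg.frac_unique[OF norm_frac[OF y]])
  fix m
  obtain k where m: "m = den y k"
    using den_surj[OF y] by blast
  have w: "frac y m = P (y k) - T' k"
    unfolding m by (rule frac_den[OF y])
  have "neg.den (frac y) m = k"
    by (simp add: neg.den_apply w blinfun.minus_left blinfun.diff_right TP QQ)
       (simp add: m den_apply blinfun.diff_right QQ)
  moreover have "P (frac y m) - (- T') m = y k"
    by (simp add: w blinfun.minus_left blinfun.diff_right PP)
       (simp add: m den_apply blinfun.diff_right T'Q)
  ultimately show "y (neg.den (frac y) m) = P (frac y m) - (- T') m"
    by simp
qed

lemma neg_frac_0: "neg.frac 0 = hat"
  by (rule neg.frac_unique) (simp_all add: neg.den_apply hat_Q blinfun.minus_left)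

end

section \<open>Holomorphic maps into the operator ball\<close>

text \<open>With \<open>D w = N w - N z\<close>, the resolvent identity applied twice gives
  \<open>G w = G z - G z D G z + G w (D G z D) G z\<close>, whose last term is of second order.\<close>

lemma has_derivative_inverse_ops:
  fixes N G :: "'b::real_normed_vector \<Rightarrow> 'a::real_normed_vector \<Rightarrow>\<^sub>L 'a"
  assumes N: "(N has_derivative N') (at z)" and S: "open S" "z \<in> S"
    and G: "\<And>w. w \<in> S \<Longrightarrow> inverse_ops (N w) (G w)" "\<And>w. w \<in> S \<Longrightarrow> norm (G w) \<le> M"
  shows "(G has_derivative (\<lambda>v. - ((G z o\<^sub>L N' v) o\<^sub>L G z))) (at z)"
proof -
  note compose = bounded_bilinear.FDERIV[OF bounded_bilinear_blinfun_compose]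
  define D where "D w = N w - N z" for w
  have D: "(D has_derivative N') (at z)" "D z = 0"
    unfolding D_def using has_derivative_diff[OF N has_derivative_const[of "N z"]] by auto
  define \<psi> where "\<psi> w = (D w o\<^sub>L G z) o\<^sub>L D w" for w
  have \<psi>: "(\<psi> has_derivative (\<lambda>_. 0)) (at z)"
    unfolding \<psi>_def
    using compose[OF compose[OF D(1) has_derivative_const[of "G z"]] D(1)] by (simp add: D(2))
  \<comment> \<open>The value 0 off \<open>S\<close>, where \<open>G\<close> is unconstrained, makes
    the estimate hold for every \<open>w\<close>. The uniform bound \<open>M\<close> stands in for
    continuity of \<open>G\<close> at \<open>z\<close>.\<close>
  define r where "r w = (if w \<in> S then (G w o\<^sub>L \<psi> w) o\<^sub>L G z else 0)" for w
  have r_le: "norm (r w) \<le> M * norm (\<psi> w) * M" for w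
  proof (cases "w \<in> S")
    case True
    have "0 \<le> M"
      using G(2)[OF S(2)] norm_ge_zero order_trans by blast
    have "norm (r w) \<le> norm (G w o\<^sub>L \<psi> w) * norm (G z)"
      using True by (simp add: r_def norm_blinfun_compose)
    also have "\<dots> \<le> (norm (G w) * norm (\<psi> w)) * norm (G z)"
      by (intro mult_right_mono norm_blinfun_compose) auto
    also have "\<dots> \<le> (M * norm (\<psi> w)) * M"
      using G(2)[OF True] G(2)[OF S(2)] \<open>0 \<le> M\<close> by (intro mult_mono) auto
    finally show ?thesis .
  next
    case False
    have "0 \<le> M"
      using G(2)[OF S(2)] norm_ge_zero order_trans by blast
    then show ?thesis
      using False by (simp add: r_def)
  qed
  have \<psi>0: "\<psi> z = 0"
    by (simp add: \<psi>_def D)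
  then have r0: "r z = 0"
    by (simp add: r_def)
  have r: "(r has_derivative (\<lambda>_. 0)) (at z)"
    unfolding has_derivative_iff_norm
  proof
    have "((\<lambda>y. norm (\<psi> y) / norm (y - z)) \<longlongrightarrow> 0) (at z)"
      using \<psi> unfolding has_derivative_iff_norm by (simp add: \<psi>0)
    then have "((\<lambda>y. (M * M) * (norm (\<psi> y) / norm (y - z))) \<longlongrightarrow> 0) (at z)"
      by (rule tendsto_mult_right_zero)
    then have "((\<lambda>y. norm (r y) / norm (y - z)) \<longlongrightarrow> 0) (at z)"
    proof (rule Lim_null_comparison[rotated])
      show "\<forall>\<^sub>F y in at z. norm (norm (r y) / norm (y - z)) \<le> (M * M) * (norm (\<psi> y) / norm (y - z))"
        using r_le by (auto intro!: always_eventually divide_right_mono simp: mult_ac)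
    qed
    then show "((\<lambda>y. norm (r y - r z - 0) / norm (y - z)) \<longlongrightarrow> 0) (at z)"
      by (simp add: r0)
  qed simp
  have "((\<lambda>w. G z - ((G z o\<^sub>L D w) o\<^sub>L G z) + r w) has_derivative
      (\<lambda>v. - ((G z o\<^sub>L N' v) o\<^sub>L G z))) (at z)"
    using has_derivative_add[OF has_derivative_diff[OF has_derivative_const
          compose[OF compose[OF has_derivative_const D(1)] has_derivative_const]] r, of "G z" "G z" "G z"]
    by simp
  moreover have "G z - ((G z o\<^sub>L D w) o\<^sub>L G z) + r w = G w" if w: "w \<in> S" for w
  proof (rule blinfun_eqI)
    fix x
    have *: "G w u = G z u - G w (D w (G z u))" for u
    proof -
      have "G w (N w (G z u)) = G z u" "N z (G z u) = u"
        using G(1)[OF w] G(1)[OF S(2)] by (simp_all add: inverse_ops_def)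
      then show ?thesis
        by (simp add: D_def blinfun.diff_left blinfun.diff_right)
    qed
    show "(G z - ((G z o\<^sub>L D w) o\<^sub>L G z) + r w) x = G w x"
      using *[of x] *[of "D w (G z x)"] w
      by (simp add: r_def \<psi>_def blinfun.diff_left blinfun.add_left blinfun.diff_right)
  qed
  ultimately show ?thesis
    by (rule has_derivative_transform_within_open[OF _ S])
qed

lemma op_unit_ball_iff: "A \<in> op_unit_ball \<longleftrightarrow> clin (blinfun_apply A) \<and> norm A < 1"
  by (simp add: op_unit_ball_def clin_def)

lemma holomorphic_on_cinner:
  assumes "holomorphic_disc_map f D"
  shows "(\<lambda>z. cinner (f z u) v) holomorphic_on ball 0 1"
proof (rule holomorphic_onI)
  fix z :: complex assume "z \<in> ball 0 1"
  then obtain f' where f': "(f has_derivative f') (at z)" "\<And>c w x. f' (c * w) x = c *\<^sub>C f' w x"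
    using assms unfolding holomorphic_disc_map_def by blast
  have "((\<lambda>z. cinner (f z u) v) has_derivative (\<lambda>w. cinner (f' w u) v)) (at z)"
    by (intro bounded_linear.has_derivative[OF bounded_linear_cinner_left]
        bounded_linear.has_derivative[OF blinfun.bounded_linear_left] f')
  moreover have "(\<lambda>w. cinner (f' w u) v) = (*) (cinner (f' 1 u) v)"
  proof
    fix w
    have "f' w u = w *\<^sub>C f' 1 u"
      using f'(2)[of w 1 u] by simp
    then show "cinner (f' w u) v = cinner (f' 1 u) v * w"
      by (simp only: cinner_scaleC_left mult.commute)
  qed
  ultimately have "((\<lambda>z. cinner (f z u) v) has_field_derivative cinner (f' 1 u) v) (at z)"
    by (simp add: has_field_derivative_def)
  then show "(\<lambda>z. cinner (f z u) v) field_differentiable at z within ball 0 1"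
    using field_differentiable_at_within field_differentiable_def by blast
qed

text \<open>Holomorphic functions from the ball to the disc, in the weak sense that suffices to
  compare with discs.\<close>

definition disc_function :: "('k::complex_inner \<Rightarrow>\<^sub>L 'h::complex_inner \<Rightarrow> complex) \<Rightarrow> bool" where
  "disc_function F \<longleftrightarrow> (\<forall>A\<in>op_unit_ball. F A \<in> ball 0 1) \<and>
     (\<forall>f. holomorphic_disc_map f op_unit_ball \<longrightarrow> (\<lambda>z. F (f z)) holomorphic_on ball 0 1)"

lemma disc_function_contracting:
  assumes "disc_function F" "holomorphic_disc_map f op_unit_ball" "a \<in> ball 0 1" "b \<in> ball 0 1"
  shows "poincare_dist (F (f a)) (F (f b)) \<le> poincare_dist a b"
  using assms by (intro poincare_dist_contracting[of "\<lambda>z. F (f z)"])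
    (auto simp: disc_function_def holomorphic_disc_map_def)

lemma disc_function_chain:
  assumes F: "disc_function F" and chain: "analytic_chain op_unit_ball x y n z' z'' f"
  shows "poincare_dist (F x) (F y) \<le> (\<Sum>k=1..n. poincare_dist (z' k) (z'' k))"
proof -
  have n: "1 \<le> n" and f1: "f 1 (z' 1) = x" and fn: "f n (z'' n) = y"
    and z: "\<And>k. k \<in> {1..n} \<Longrightarrow> z' k \<in> ball 0 1 \<and> z'' k \<in> ball 0 1 \<and> holomorphic_disc_map (f k) op_unit_ball"
    and link: "\<And>k. k \<in> {1..<n} \<Longrightarrow> f k (z'' k) = f (Suc k) (z' (Suc k))"
    using chain unfolding analytic_chain_def by auto
  have F_in: "F (f k w) \<in> ball 0 1" if "k \<in> {1..n}" "w \<in> ball 0 1" for k w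
    using F z[OF that(1)] that(2) unfolding disc_function_def holomorphic_disc_map_def by blast
  have step: "poincare_dist (F (f k (z' k))) (F (f k (z'' k))) \<le> poincare_dist (z' k) (z'' k)"
    if "k \<in> {1..n}" for k
    using disc_function_contracting[OF F] z[OF that] by blast
  \<comment> \<open>Induction over initial pieces of the fixed chain, hence the guard
    \<open>m \<le> n\<close> and the start at 1.\<close>
  have "m \<le> n \<longrightarrow> poincare_dist (F x) (F (f m (z'' m))) \<le> (\<Sum>k=1..m. poincare_dist (z' k) (z'' k))"
    if "1 \<le> m" for m
    using that
  proof (induction m rule: dec_induct)
    case base
    then show ?case
      using step[of 1] n f1 by simp
  next
    case (step m)
    show ?case
    proof
      assume m: "Suc m \<le> n"
      then have k: "1 \<in> {1..n}" "m \<in> {1..n}" "Suc m \<in> {1..n}" "m \<in> {1..<n}"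
        using step.hyps by auto
      have "poincare_dist (F x) (F (f (Suc m) (z'' (Suc m)))) \<le>
          poincare_dist (F x) (F (f m (z'' m))) +
          poincare_dist (F (f m (z'' m))) (F (f (Suc m) (z'' (Suc m))))"
        using F_in[OF k(1), of "z' 1"] F_in[OF k(2), of "z'' m"] F_in[OF k(3), of "z'' (Suc m)"]
          z[OF k(1)] z[OF k(2)] z[OF k(3)] f1
        by (intro poincare_dist_triangle) auto
      moreover have "poincare_dist (F (f m (z'' m))) (F (f (Suc m) (z'' (Suc m)))) \<le>
          poincare_dist (z' (Suc m)) (z'' (Suc m))"
        using \<open>\<And>k. k \<in> {1..n} \<Longrightarrow> _ k \<le> _ k\<close>[OF k(3)] link[OF k(4)] by simp
      ultimately show "poincare_dist (F x) (F (f (Suc m) (z'' (Suc m)))) \<le>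
          (\<Sum>k=1..Suc m. poincare_dist (z' k) (z'' k))"
        using step.IH m by simp
    qed
  qed
  then show ?thesis
    using n fn by blast
qed

context ball_automorphism
begin

lemma frac_in_ball: "y \<in> op_unit_ball \<Longrightarrow> frac y \<in> op_unit_ball"
  by (simp add: op_unit_ball_iff norm_frac clin_frac)

lemma hat_in_ball: "hat \<in> op_unit_ball"
  by (simp add: op_unit_ball_iff norm_hat clin_hat)

text \<open>The product rule, with \<open>has_derivative_inverse_ops\<close> for the factor
  \<open>iden (f z)\<close>. The derivative is complex-linear since it is built from
  \<open>f'\<close> and complex-linear operators.\<close>

lemma holomorphic_frac:
  assumes f: "holomorphic_disc_map f op_unit_ball"
  shows "holomorphic_disc_map (\<lambda>z. frac (f z)) op_unit_ball"
  unfolding holomorphic_disc_map_def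
proof (intro ballI conjI)
  fix z :: complex assume z: "z \<in> ball 0 1"
  have f_in: "f w \<in> op_unit_ball" if "w \<in> ball 0 1" for w
    using f that unfolding holomorphic_disc_map_def by blast
  then have n: "norm (f w) < 1" if "w \<in> ball 0 1" for w
    using that by (auto simp: op_unit_ball_iff)
  show "frac (f z) \<in> op_unit_ball"
    using f_in[OF z] by (rule frac_in_ball)
  obtain f' where f': "(f has_derivative f') (at z)" "\<And>c w x. f' (c * w) x = c *\<^sub>C f' w x"
    using f z unfolding holomorphic_disc_map_def by blast
  note compose = bounded_bilinear.FDERIV[OF bounded_bilinear_blinfun_compose]
  have "((\<lambda>w. den (f w)) has_derivative (\<lambda>v. 0 - (T o\<^sub>L f' v))) (at z)"
    unfolding den_def
    by (intro has_derivative_diff has_derivative_const)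
       (use compose[OF has_derivative_const f'(1), of T] in simp)
  then have "((\<lambda>w. iden (f w)) has_derivative
      (\<lambda>v. - ((iden (f z) o\<^sub>L (0 - (T o\<^sub>L f' v))) o\<^sub>L iden (f z)))) (at z)"
    by (rule has_derivative_inverse_ops[OF _ open_ball z]) (use n iden norm_iden in auto)
  moreover have "((\<lambda>w. (P o\<^sub>L f w) - T') has_derivative (\<lambda>v. (P o\<^sub>L f' v) - 0)) (at z)"
    by (intro has_derivative_diff has_derivative_const)
       (use compose[OF has_derivative_const f'(1), of P] in simp)
  ultimately have der: "((\<lambda>w. frac (f w)) has_derivative
      (\<lambda>v. (((P o\<^sub>L f z) - T') o\<^sub>L - ((iden (f z) o\<^sub>L (0 - (T o\<^sub>L f' v))) o\<^sub>L iden (f z))) +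
           (((P o\<^sub>L f' v) - 0) o\<^sub>L iden (f z)))) (at z)"
    unfolding frac_def by (rule compose[rotated])
  have clin_G: "clin (iden (f z))" "clin (f z)"
    using clin_iden[OF n[OF z]] f_in[OF z] by (auto simp: op_unit_ball_iff)
  show "\<exists>f'. ((\<lambda>w. frac (f w)) has_derivative f') (at z) \<and>
      (\<forall>c w x. f' (c * w) x = c *\<^sub>C f' w x)"
  proof (rule exI, rule conjI, rule der)
  qed (use clin clin_G in \<open>auto simp: f'(2) clin_def blinfun.minus_left blinfun.minus_right
      blinfun.diff_left blinfun.add_left scaleC_diff_right scaleC_add_right scaleC_minus_right\<close>)
qed

end

section \<open>Distances from the transform: extremal disc and extremal functions\<close>

context ball_automorphism
begin

interpretation neg: ball_automorphism "- T" "- T'" P P' Q Q'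
  by (rule ball_automorphism_uminus)

lemma disc_exists:
  assumes y: "y \<in> op_unit_ball"
  shows "\<exists>f. holomorphic_disc_map f op_unit_ball \<and> f 0 = hat \<and> f (of_real (norm (frac y))) = y"
proof -
  \<comment> \<open>If \<open>frac y = 0\<close>, division by zero gives \<open>w = 0\<close>; hence
    only \<open>norm w \<le> 1\<close> is claimed.\<close>
  define w where "w = (1 / norm (frac y)) *\<^sub>R frac y"
  have w: "norm (frac y) *\<^sub>R w = frac y" "norm w \<le> 1"
    by (auto simp: w_def)
  have yb: "norm y < 1" "clin (blinfun_apply y)"
    using y by (auto simp: op_unit_ball_iff)
  have cw: "w (c *\<^sub>C x) = c *\<^sub>C w x" for c x
    using clin_frac[OF yb] by (simp add: w_def clin_def blinfun.scaleR_left scaleR_scaleC_commute)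
  \<comment> \<open>The operator type has only real scalars, so the line
    \<open>z \<mapsto> z w\<close> is assembled from \<open>w\<close> and \<open>j\<close> composed
    with \<open>w\<close>.\<close>
  define j :: "'h \<Rightarrow>\<^sub>L 'h" where "j = Blinfun (\<lambda>x. \<i> *\<^sub>C x)"
  have j: "j x = \<i> *\<^sub>C x" for x
    by (simp add: j_def bounded_linear_Blinfun_apply bounded_linear_scaleC_right)
  define L where "L z = Re z *\<^sub>R w + Im z *\<^sub>R (j o\<^sub>L w)" for z
  have L: "L z x = z *\<^sub>C w x" for z x
  proof -
    have "L z x = (of_real (Re z) + of_real (Im z) * \<i>) *\<^sub>C w x"
      by (simp add: L_def blinfun.add_left blinfun.scaleR_left j scaleR_scaleC scaleC_scaleC
          scaleC_add_left)
    also have "of_real (Re z) + of_real (Im z) * \<i> = z"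
      by (simp add: complex_eq_iff)
    finally show ?thesis .
  qed
  have "bounded_linear L"
    unfolding L_def by (intro bounded_linear_intros bounded_linear_Re bounded_linear_Im)
  then have L': "(L has_derivative L) (at z)" for z
    by (rule bounded_linear_imp_has_derivative)
  have "norm (L z) \<le> cmod z" for z
  proof (rule norm_blinfun_bound)
    fix x
    show "norm (L z x) \<le> cmod z * norm x"
      unfolding L norm_scaleC using w(2)
      by (intro mult_left_mono order_trans[OF norm_blinfun[of w x]] mult_left_le_one_le) auto
  qed simp
  then have "holomorphic_disc_map L op_unit_ball"
    unfolding holomorphic_disc_map_def
  proof (intro ballI conjI exI allI)
    fix z :: complex assume "z \<in> ball 0 1"
    then show "L z \<in> op_unit_ball"
      using \<open>\<And>z. norm (L z) \<le> cmod z\<close>[of z]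
      by (simp add: op_unit_ball_iff clin_def L cw scaleC_scaleC mult.commute)
    show "(L has_derivative L) (at z)"
      by (rule L')
    show "L (c * w) x = c *\<^sub>C L w x" for c w x
      by (simp add: L scaleC_scaleC)
  qed
  then have "holomorphic_disc_map (\<lambda>z. neg.frac (L z)) op_unit_ball"
    by (rule neg.holomorphic_frac)
  moreover have "L 0 = 0" "L (of_real (norm (frac y))) = frac y"
    using w by (simp_all add: L_def)
  ultimately show ?thesis
    using neg_frac_0 neg_frac_frac[OF yb(1)] by (intro exI[of _ "\<lambda>z. neg.frac (L z)"]) simp
qed

lemma disc_function_le:
  assumes F: "disc_function F" and y: "y \<in> op_unit_ball"
  shows "poincare_dist (F hat) (F y) \<le> artanh (norm (frac y))"
proof -
  obtain f where f: "holomorphic_disc_map f op_unit_ball" "f 0 = hat" "f (of_real (norm (frac y))) = y"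
    using disc_exists[OF y] by blast
  have "norm (frac y) < 1"
    using frac_in_ball[OF y] by (simp add: op_unit_ball_iff)
  then show ?thesis
    using disc_function_contracting[OF F f(1), of 0 "of_real (norm (frac y))"] f(2,3)
    by (simp add: poincare_dist_def)
qed

text \<open>The norm of \<open>frac y\<close> may not be attained in the generality of this locale,
  so a smaller \<open>r\<close> is refuted by a vector \<open>u\<close> that \<open>frac y\<close>
  stretches by more than \<open>tanh r\<close>. Pairing with its image \<open>v\<close>, normalised,
  gives a function vanishing at \<open>hat\<close> with modulus \<open>norm v / norm u\<close> at
  \<open>y\<close>.\<close>

lemma artanh_norm_frac_le:
  assumes y: "y \<in> op_unit_ball"
    and le: "\<And>F. disc_function F \<Longrightarrow> poincare_dist (F hat) (F y) \<le> r"
  shows "artanh (norm (frac y)) \<le> r"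
proof (rule ccontr)
  assume r: "\<not> artanh (norm (frac y)) \<le> r"
  \<comment> \<open>The constant function yields \<open>0 \<le> r\<close>, so that
    \<open>tanh r\<close> qualifies as an operator bound.\<close>
  have "disc_function (\<lambda>_::'k \<Rightarrow>\<^sub>L 'h. 0)"
    by (simp add: disc_function_def)
  then have r0: "0 \<le> r"
    using le by (fastforce simp: poincare_dist_def)
  have n: "norm (frac y) < 1"
    using frac_in_ball[OF y] by (simp add: op_unit_ball_iff)
  have t: "tanh r < norm (frac y)"
    using r artanh_real_mono[of "norm (frac y)" "tanh r"] tanh_real_lt_1[of r]
    by (force simp: artanh_tanh_real)
  then obtain u where u: "tanh r * norm u < norm (frac y u)"
    using norm_blinfun_bound[of "tanh r" "frac y"] r0 by (meson not_le tanh_real_nonneg_iff)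
  define v where "v = frac y u"
  have v: "0 < norm v"
    using u r0 by (simp add: v_def)
      (metis mult_nonneg_nonneg norm_ge_zero norm_zero order.strict_trans1 order_less_irrefl tanh_real_nonneg_iff zero_less_norm_iff)
  then have u0: "0 < norm u"
    by (auto simp: v_def)
  define F where "F A = cinner (frac A u) v / of_real (norm u * norm v)" for A
  have "disc_function F"
    unfolding disc_function_def
  proof (intro conjI ballI allI impI)
    fix A :: "'k \<Rightarrow>\<^sub>L 'h" assume A: "A \<in> op_unit_ball"
    have "cmod (cinner (frac A u) v) \<le> norm (frac A u) * norm v"
      by (rule norm_cinner_le)
    also have "\<dots> \<le> norm (frac A) * norm u * norm v"
      by (intro mult_right_mono norm_blinfun) simp
    also have "\<dots> < 1 * norm u * norm v"
      using frac_in_ball[OF A] u0 v by (intro mult_strict_right_mono) (auto simp: op_unit_ball_iff)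
    finally show "F A \<in> ball 0 1"
      using u0 v by (simp add: F_def norm_divide norm_mult)
  next
    fix f :: "complex \<Rightarrow> 'k \<Rightarrow>\<^sub>L 'h" assume "holomorphic_disc_map f op_unit_ball"
    then have "(\<lambda>z. cinner (frac (f z) u) v) holomorphic_on ball 0 1"
      by (intro holomorphic_on_cinner[of _ op_unit_ball] holomorphic_frac)
    then show "(\<lambda>z. F (f z)) holomorphic_on ball 0 1"
      unfolding F_def using u0 v by (intro holomorphic_intros) auto
  qed
  then have "poincare_dist (F hat) (F y) \<le> r"
    by (rule le)
  moreover have "F hat = 0"
    by (simp add: F_def frac_hat cinner_zero_left)
  moreover have "cmod (F y) = norm v / norm u"
    using v by (simp add: F_def v_def[symmetric] cinner_self norm_divide norm_mult power2_eq_square)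
  ultimately have "artanh (norm v / norm u) \<le> artanh (tanh r)"
    by (simp add: poincare_dist_def artanh_tanh_real)
  moreover have "norm v / norm u < 1"
  proof -
    have "norm v \<le> norm (frac y) * norm u"
      unfolding v_def by (rule norm_blinfun)
    also have "\<dots> < 1 * norm u"
      using n u0 by (intro mult_strict_right_mono)
    finally show ?thesis
      using u0 by simp
  qed
  ultimately have "norm v / norm u \<le> tanh r"
    using r0 tanh_real_lt_1[of r] by (simp add: artanh_real_le_iff)
  then show False
    using u u0 by (simp add: v_def field_simps)
qed

text \<open>Distances from \<open>hat\<close> suffice, because every closed operator gets its own
  instance of the locale in which its transform is \<open>hat\<close>.\<close>

lemma kobayashi_hat:
  assumes y: "y \<in> op_unit_ball"
  shows "kobayashi op_unit_ball hat y = ereal (artanh (norm (frac y)))"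
proof (rule antisym)
  obtain f where f: "holomorphic_disc_map f op_unit_ball" "f 0 = hat" "f (of_real (norm (frac y))) = y"
    using disc_exists[OF y] by blast
  have n: "norm (frac y) < 1"
    using frac_in_ball[OF y] by (simp add: op_unit_ball_iff)
  have "analytic_chain op_unit_ball hat y 1 (\<lambda>_. 0) (\<lambda>_. of_real (norm (frac y))) (\<lambda>_. f)"
    using f n by (simp add: analytic_chain_def)
  moreover have "artanh (norm (frac y)) = (\<Sum>k=1..1::nat. poincare_dist 0 (of_real (norm (frac y))))"
    by (simp add: poincare_dist_def)
  ultimately show "kobayashi op_unit_ball hat y \<le> ereal (artanh (norm (frac y)))"
    unfolding kobayashi_def
    by - (rule Inf_lower, rule CollectI, rule exI[of _ 1], rule exI[of _ "\<lambda>_. 0"],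
        rule exI[of _ "\<lambda>_. of_real (norm (frac y))"], rule exI[of _ "\<lambda>_. f"], simp)
next
  show "ereal (artanh (norm (frac y))) \<le> kobayashi op_unit_ball hat y"
    unfolding kobayashi_def
  proof (rule Inf_greatest)
    fix s
    assume "s \<in> {ereal (\<Sum>k=1..n. poincare_dist (z' k) (z'' k)) | n z' z'' f.
        analytic_chain op_unit_ball hat y n z' z'' f}"
    then obtain n z' z'' f where s: "s = ereal (\<Sum>k=1..n. poincare_dist (z' k) (z'' k))"
      and chain: "analytic_chain op_unit_ball hat y n z' z'' f"
      by blast
    show "ereal (artanh (norm (frac y))) \<le> s"
      unfolding s ereal_less_eq
      by (rule artanh_norm_frac_le[OF y]) (rule disc_function_chain[OF _ chain])
  qed
qed

end

section \<open>Graphs of bounded operators\<close>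

lemma mem_graph_of: "(x, y) \<in> graph_of A \<longleftrightarrow> y = A x"
  by (auto simp: graph_of_def)

lemma graph_of_inject: "graph_of A = graph_of B \<longleftrightarrow> A = B"
  by (metis blinfun_eqI mem_graph_of)

lemma bounded_op_graph_of: "bounded_op (graph_of A) = A"
  by (simp add: bounded_op_def graph_of_inject)

lemma Id_eq_graph_of: "Id = graph_of id_blinfun"
  by (auto simp: graph_of_def)

lemma op_add_graph_of: "graph_of A \<oplus>\<^sub>o graph_of B = graph_of (A + B)"
  by (auto simp: op_add_def graph_of_def blinfun.add_left)

lemma op_diff_graph_of: "graph_of A \<ominus>\<^sub>o graph_of B = graph_of (A - B)"
  by (auto simp: op_diff_def graph_of_def blinfun.diff_left)

lemma op_comp_graph_of: "graph_of A \<odot>\<^sub>o graph_of B = graph_of (A o\<^sub>L B)"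
  by (auto simp: op_comp_def graph_of_def)

lemma converse_graph_of: "inverse_ops A B \<Longrightarrow> (graph_of A)\<inverse> = graph_of B"
  by (rule set_eqI, rule prod.induct) (metis converse_iff inverse_ops_def mem_graph_of)

lemma op_adjoint_graph_of:
  fixes A :: "'a::complex_inner \<Rightarrow>\<^sub>L 'b::complex_inner" and B :: "'b \<Rightarrow>\<^sub>L 'a"
  assumes "clin (blinfun_apply A)" "\<And>x y. inner (A x) y = inner x (B y)"
  shows "op_adjoint (graph_of A) = graph_of B"
proof -
  have "(\<forall>x. cinner (A x) y = cinner x z) \<longleftrightarrow> z = B y" for y z
  proof
    assume *: "\<forall>x. cinner (A x) y = cinner x z"
    show "z = B y"
      by (rule vector_eq_ldot[THEN iffD1])
         (simp add: inner_eq_Re_cinner cinner_adjoint[OF assms, symmetric] *[rule_format, symmetric])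
  qed (simp add: cinner_adjoint[OF assms])
  then show ?thesis
    by (auto simp: op_adjoint_def graph_of_def)
qed

lemma positive_selfadjoint_graph_of:
  fixes R :: "'a::complex_hilbert \<Rightarrow>\<^sub>L 'a"
  assumes R: "clin (blinfun_apply R)" "selfadj R" and pos: "\<And>x. 0 \<le> inner (R x) x"
  shows "positive_selfadjoint (graph_of R)"
proof -
  have sa: "inner (R x) y = inner x (R y)" for x y
    using R(2) by (simp add: selfadj_def)
  have "linear_op (graph_of R)"
    using clinD[OF R(1)]
    by (auto simp: linear_op_def mem_graph_of blinfun.add_right single_valued_def)
  moreover have "Domain (graph_of R) = UNIV"
    by (auto simp: graph_of_def)
  then have "densely_defined (graph_of R)"
    by (simp add: densely_defined_def)
  moreover have "op_adjoint (graph_of R) = graph_of R"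
    by (rule op_adjoint_graph_of[OF R(1) sa])
  moreover have "cinner (R x) x \<in> \<real> \<and> 0 \<le> Re (cinner (R x) x)" for x
    using cinner_adjoint[OF R(1) sa, of x x] cinner_commute[of x "R x"] pos[of x]
    by (simp add: Reals_cnj_iff inner_eq_Re_cinner)
  ultimately show ?thesis
    by (auto simp: positive_selfadjoint_def graph_of_def)
qed

text \<open>If \<open>P\<close> squared is everywhere defined, so is \<open>P\<close>, and symmetry
  bounds the squared norm of \<open>P x\<close> by \<open>inner (A x) x\<close>. This reduces the
  candidates in \<open>op_sqrt\<close> to bounded ones.\<close>

lemma square_root_bounded:
  fixes A :: "'a::complex_hilbert \<Rightarrow>\<^sub>L 'a"
  assumes P: "positive_selfadjoint P" and square: "P \<odot>\<^sub>o P = graph_of A"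
  shows "\<exists>p. P = graph_of p"
proof -
  have lin: "linear_op P" and adjoint: "op_adjoint P = P"
    using P by (auto simp: positive_selfadjoint_def)
  have "\<exists>y. (x, y) \<in> P" for x
  proof -
    have "(x, A x) \<in> P \<odot>\<^sub>o P"
      by (simp add: square mem_graph_of)
    then show ?thesis
      by (auto simp: op_comp_def)
  qed
  then obtain p where p: "\<And>x. (x, p x) \<in> P"
    by metis
  have P_iff: "(x, y) \<in> P \<longleftrightarrow> y = p x" for x y
    using lin p by (auto simp: linear_op_def single_valued_def)
  have "(x, p (p x)) \<in> P \<odot>\<^sub>o P" for x
    using p by (auto simp: op_comp_def)
  then have pp: "p (p x) = A x" for x
    by (simp add: square mem_graph_of)
  have sym: "inner (p x) y = inner x (p y)" for x y
  proof -
    have "(y, p y) \<in> op_adjoint P"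
      using p adjoint by simp
    then have "cinner (p x) y = cinner x (p y)"
      using p[of x] by (auto simp: op_adjoint_def)
    then show ?thesis
      by (simp add: inner_eq_Re_cinner)
  qed
  have "bounded_linear p"
  proof (rule bounded_linear_intro)
    show "p (x + y) = p x + p y" for x y
      using lin p unfolding linear_op_def by (metis P_iff)
    show "p (r *\<^sub>R x) = r *\<^sub>R p x" for r x
      using lin p unfolding linear_op_def scaleR_scaleC by (metis P_iff)
    fix x
    have "(norm (p x))\<^sup>2 = inner (A x) x"
      by (simp add: power2_norm_eq_inner sym pp inner_commute)
    also have "\<dots> \<le> norm (A x) * norm x"
      by (rule norm_cauchy_schwarz)
    also have "\<dots> \<le> norm A * norm x * norm x"
      by (intro mult_right_mono norm_blinfun) simp
    finally have "norm (p x) \<le> sqrt (norm A * (norm x)\<^sup>2)"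
      by (intro real_le_rsqrt) (simp add: power2_eq_square mult.assoc)
    then show "norm (p x) \<le> norm x * sqrt (norm A)"
      by (simp add: real_sqrt_mult mult.commute)
  qed
  then have "P = graph_of (Blinfun p)"
    using P_iff by (auto simp: mem_graph_of bounded_linear_Blinfun_apply)
  then show ?thesis ..
qed

text \<open>The last conjunct, uniqueness among bounded operators, later identifies an explicit
  formula for a root.\<close>

lemma op_sqrt_graph_of:
  fixes A :: "'a::complex_hilbert \<Rightarrow>\<^sub>L 'a"
  assumes A: "clin (blinfun_apply A)" "selfadj A" "\<And>x. (norm x)\<^sup>2 \<le> inner (A x) x"
  shows "\<exists>R. op_sqrt (graph_of A) = graph_of R \<and> clin (blinfun_apply R) \<and> selfadj R \<and>
    (\<exists>c>0. \<forall>x. c * (norm x)\<^sup>2 \<le> inner (R x) x) \<and> (\<forall>x. R (R x) = A x) \<and>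
    (\<forall>P :: 'a \<Rightarrow>\<^sub>L 'a. (\<forall>x. 0 \<le> inner (P x) x) \<and> (\<forall>x. P (P x) = A x) \<longrightarrow> (\<forall>x. P x = R x))"
proof -
  obtain R c where R: "selfadj R" "0 < c" "\<And>x. c * (norm x)\<^sup>2 \<le> inner (R x) x" "\<And>x. R (R x) = A x"
    and comm: "\<And>(Z::'a \<Rightarrow>\<^sub>L 'a) x. (\<And>x. Z (A x) = A (Z x)) \<Longrightarrow> Z (R x) = R (Z x)"
    using sqrt_exists[OF A(2,3)] by blast
  have clin_R: "clin (blinfun_apply R)"
    using A(1) comm by (rule clin_commute_scaleC)
  have uniq: "(P :: 'a \<Rightarrow>\<^sub>L 'a) = R" if "\<And>x. 0 \<le> inner (P x) x" "\<And>x. P (P x) = A x" for P :: "'a \<Rightarrow>\<^sub>L 'a"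
    by (rule sqrt_unique[OF R(2,3,4) comm that])
  have "0 \<le> inner (R x) x" for x
    using R(2) R(3)[of x] by (meson less_imp_le mult_nonneg_nonneg order_trans zero_le_power2)
  then have "positive_selfadjoint (graph_of R)"
    by (rule positive_selfadjoint_graph_of[OF clin_R R(1)])
  moreover have "graph_of R \<odot>\<^sub>o graph_of R = graph_of A"
    by (simp add: op_comp_graph_of graph_of_inject) (rule blinfun_eqI, simp add: R)
  moreover have "P = graph_of R" if P: "positive_selfadjoint P" "P \<odot>\<^sub>o P = graph_of A" for P
  proof -
    obtain p where p: "P = graph_of p"
      using square_root_bounded[OF P] by blast
    have "0 \<le> inner (p x) x" for x
      using P(1) by (auto simp: p positive_selfadjoint_def graph_of_def inner_eq_Re_cinner)
    moreover have "p o\<^sub>L p = A"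
      using P(2) by (simp add: p op_comp_graph_of graph_of_inject)
    then have "p (p x) = A x" for x
      by (metis blinfun_apply_blinfun_compose)
    ultimately have "p = R"
      by (rule uniq)
    then show ?thesis
      by (simp add: p)
  qed
  ultimately have root: "op_sqrt (graph_of A) = graph_of R"
    unfolding op_sqrt_def
    using the_equality[of "\<lambda>P. positive_selfadjoint P \<and> P \<odot>\<^sub>o P = graph_of A" "graph_of R"]
    by blast
  have only: "\<forall>P :: 'a \<Rightarrow>\<^sub>L 'a. (\<forall>x. 0 \<le> inner (P x) x) \<and> (\<forall>x. P (P x) = A x) \<longrightarrow> (\<forall>x. P x = R x)"
    using uniq by metis
  have coercive: "\<exists>c>0. \<forall>x. c * (norm x)\<^sup>2 \<le> inner (R x) x"
    using R(2,3) by metis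
  have square: "\<forall>x. R (R x) = A x"
    by (simp add: R(4))
  show ?thesis
    by (intro exI[of _ R] conjI root clin_R R(1) coercive square only)
qed

text \<open>The defect operators are linked by \<open>(I + T*T)\<^sup>1\<^sup>/\<^sup>2 = I + T* ((I + TT*)\<^sup>1\<^sup>/\<^sup>2 + I)\<^sup>-\<^sup>1 T\<close>,
  which yields the intertwining relations.\<close>

lemma ball_automorphism_exists:
  fixes T :: "'h::complex_hilbert \<Rightarrow>\<^sub>L 'k::complex_hilbert"
  assumes T: "clin (blinfun_apply T)"
  shows "\<exists>P P' Q Q'. ball_automorphism T (adj T) P P' Q Q' \<and>
    op_sqrt (Id \<oplus>\<^sub>o op_adjoint (graph_of T) \<odot>\<^sub>o graph_of T) = graph_of P \<and>
    op_sqrt (Id \<oplus>\<^sub>o graph_of T \<odot>\<^sub>o op_adjoint (graph_of T)) = graph_of Q"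
proof -
  define T' where "T' = adj T"
  have adj: "inner (T x) y = inner x (T' y)" for x y
    unfolding T'_def by (rule adj)
  have adj': "inner (T' y) x = inner y (T x)" for x y
    by (metis adj inner_commute)
  have T': "clin (blinfun_apply T')"
    by (rule clin_adjoint[OF T adj])
  have op_adj: "op_adjoint (graph_of T) = graph_of T'"
    by (rule op_adjoint_graph_of[OF T adj])
  define A where "A = id_blinfun + (T' o\<^sub>L T)"
  define B where "B = id_blinfun + (T o\<^sub>L T')"
  have A: "A x = x + T' (T x)" and B: "B y = y + T (T' y)" for x y
    by (simp_all add: A_def B_def blinfun.add_left)
  have A_sqrt: "clin (blinfun_apply A)" "selfadj A" "\<And>x. (norm x)\<^sup>2 \<le> inner (A x) x"
    using T T' by (simp_all add: clin_def selfadj_def A scaleC_add_right inner_add_left inner_add_right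
        power2_norm_eq_inner adj' adj[symmetric])
  have B_sqrt: "clin (blinfun_apply B)" "selfadj B" "\<And>x. (norm x)\<^sup>2 \<le> inner (B x) x"
    using T T' by (simp_all add: clin_def selfadj_def B scaleC_add_right inner_add_left inner_add_right
        power2_norm_eq_inner adj adj'[symmetric])
  obtain P :: "'h \<Rightarrow>\<^sub>L 'h" and c where P: "op_sqrt (graph_of A) = graph_of P" "clin (blinfun_apply P)" "selfadj P"
      "0 < c" "\<And>x. c * (norm x)\<^sup>2 \<le> inner (P x) x" "\<And>x. P (P x) = A x"
    and uniq: "\<And>Z :: 'h \<Rightarrow>\<^sub>L 'h. (\<forall>x. 0 \<le> inner (Z x) x) \<Longrightarrow> (\<forall>x. Z (Z x) = A x) \<Longrightarrow> (\<forall>x. Z x = P x)"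
    using op_sqrt_graph_of[OF A_sqrt] by blast
  obtain Q d where Q: "op_sqrt (graph_of B) = graph_of Q" "clin (blinfun_apply Q)" "selfadj Q"
      "0 < d" "\<And>x. d * (norm x)\<^sup>2 \<le> inner (Q x) x" "\<And>x. Q (Q x) = B x"
    using op_sqrt_graph_of[OF B_sqrt] by blast
  obtain P' where P': "inverse_ops P P'"
    using coercive_inverse[OF P(4,5)] by blast
  obtain Q' where Q': "inverse_ops Q Q'"
    using coercive_inverse[OF Q(4,5)] by blast
  have Q_pos: "0 \<le> inner (Q y) y" for y
    using Q(4) Q(5)[of y] by (meson less_imp_le mult_nonneg_nonneg order_trans zero_le_power2)
  have "1 * (norm y)\<^sup>2 \<le> inner ((Q + id_blinfun) y) y" for y
    using Q_pos[of y] by (simp add: blinfun.add_left inner_add_left power2_norm_eq_inner)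
  then obtain G where "inverse_ops (Q + id_blinfun) G"
    using coercive_inverse[of 1 "Q + id_blinfun"] by auto
  then have G: "Q (G y) + G y = y" "G (Q y + y) = y" for y
    by (auto simp: inverse_ops_def blinfun.add_left)
  have G_pos: "0 \<le> inner (G y) y" for y
    using Q_pos[of "G y"] G(1)[of y]
    by (metis add_nonneg_nonneg inner_add_right inner_commute inner_ge_zero)
  have TT': "T (T' y) = Q (Q y) - y" for y
    by (simp add: Q B)
  \<comment> \<open>\<open>T P0 = Q T\<close> because \<open>T T' = Q\<^sup>2 - I\<close> has the
    factor \<open>Q + I\<close>, which \<open>G\<close> cancels; then \<open>G (Q + I) = I\<close>
    gives \<open>P0\<^sup>2 = A\<close>.\<close>
  define P0 where "P0 = id_blinfun + (T' o\<^sub>L (G o\<^sub>L T))"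
  have P0: "P0 x = x + T' (G (T x))" for x
    by (simp add: P0_def blinfun.add_left)
  have TP0: "T (P0 x) = Q (T x)" for x
  proof -
    have "T (P0 x) = T x + (Q (Q (G (T x)) + G (T x)) - (Q (G (T x)) + G (T x)))"
      by (simp add: P0 TT' blinfun.add_right)
    then show ?thesis
      by (simp add: G)
  qed
  have "\<forall>x. P0 x = P x"
  proof (rule uniq; intro allI)
    fix x
    have "inner (T' (G (T x))) x = inner (G (T x)) (T x)"
      by (metis adj inner_commute)
    then show "0 \<le> inner (P0 x) x"
      using G_pos[of "T x"] by (simp add: P0 inner_add_left)
    have "P0 (P0 x) = x + T' (G (T x) + G (Q (T x)))"
      by (simp add: P0[of "P0 x"] TP0 blinfun.add_right) (simp add: P0)
    also have "G (T x) + G (Q (T x)) = T x"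
      using G(2)[of "T x"] by (simp add: blinfun.add_right add.commute)
    finally show "P0 (P0 x) = A x"
      by (simp add: A)
  qed
  then have TP: "T (P x) = Q (T x)" for x
    using TP0 by simp
  have T'Q: "T' (Q y) = P (T' y)" for y
    by (rule vector_eq_ldot[THEN iffD1])
       (metis P(3) Q(3) TP adj selfadj_def)
  have "ball_automorphism T T' P P' Q Q'"
    by unfold_locales (rule T T' P(2,3) Q(2,3) P' Q' TP T'Q adj | simp only: P(6) Q(6) A B)+
  moreover have "Id \<oplus>\<^sub>o graph_of T' \<odot>\<^sub>o graph_of T = graph_of A"
    by (simp add: Id_eq_graph_of op_comp_graph_of op_add_graph_of A_def)
  moreover have "Id \<oplus>\<^sub>o graph_of T \<odot>\<^sub>o graph_of T' = graph_of B"
    by (simp add: Id_eq_graph_of op_comp_graph_of op_add_graph_of B_def)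
  ultimately show ?thesis
    using P(1) Q(1) unfolding op_adj T'_def[symmetric] by metis
qed

section \<open>Closed operators into a finite-dimensional space\<close>

text \<open>Both sides are linear in \<open>x\<close>, so members of \<open>C\<close> suffice. A
  zero vector in \<open>C\<close> is harmless: its summand is 0.\<close>

lemma orthogonal_expansion:
  fixes C :: "'a::real_inner set"
  assumes C: "finite C" "pairwise orthogonal C" and x: "x \<in> span C"
  shows "x = (\<Sum>c\<in>C. (inner x c / inner c c) *\<^sub>R c)"
  using x
proof (rule span_induct)
  show "subspace {x. x = (\<Sum>c\<in>C. (inner x c / inner c c) *\<^sub>R c)}"
    by (rule subspaceI)
       (simp_all add: inner_add_left add_divide_distrib scaleR_add_left sum.distrib,
        metis (mono_tags, lifting) scaleR_sum_right scaleR_scaleR sum.cong times_divide_eq_right)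
  fix b assume b: "b \<in> C"
  have "(\<Sum>c\<in>C. (inner b c / inner c c) *\<^sub>R c) = (\<Sum>c\<in>C. if c = b then b else 0)"
    using C(2) b by (intro sum.cong) (auto simp: pairwise_def orthogonal_def)
  then show "b = (\<Sum>c\<in>C. (inner b c / inner c c) *\<^sub>R c)"
    using C(1) b by simp
qed

text \<open>Adding a vector \<open>b\<close> gives a continuous image of an interval times the
  previous compact set.\<close>

lemma compact_bounded_combinations:
  fixes C :: "'a::real_normed_vector set"
  assumes "finite C"
  shows "compact {(\<Sum>c\<in>C. a c *\<^sub>R c) | a. \<forall>c\<in>C. \<bar>a c\<bar> \<le> (M::real)}"
  using assms
proof (induction C rule: finite_induct)
  case empty
  then show ?case
    by simp
next
  case (insert b C)
  have "{(\<Sum>c\<in>insert b C. a c *\<^sub>R c) | a. \<forall>c\<in>insert b C. \<bar>a c\<bar> \<le> M} =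
      (\<lambda>p. fst p *\<^sub>R b + snd p) ` ({-M..M} \<times> {(\<Sum>c\<in>C. a c *\<^sub>R c) | a. \<forall>c\<in>C. \<bar>a c\<bar> \<le> M})"
    (is "?A = ?B")
  proof
    show "?A \<subseteq> ?B"
    proof
      fix x assume "x \<in> ?A"
      then obtain a where a: "x = (\<Sum>c\<in>insert b C. a c *\<^sub>R c)" "\<forall>c\<in>insert b C. \<bar>a c\<bar> \<le> M"
        by blast
      show "x \<in> ?B"
        using a insert.hyps by (intro image_eqI[of _ _ "(a b, \<Sum>c\<in>C. a c *\<^sub>R c)"]) (auto simp: abs_le_iff)
    qed
    show "?B \<subseteq> ?A"
    proof
      fix x assume "x \<in> ?B"
      then obtain t a where a: "x = t *\<^sub>R b + (\<Sum>c\<in>C. a c *\<^sub>R c)" "\<bar>t\<bar> \<le> M" "\<forall>c\<in>C. \<bar>a c\<bar> \<le> M"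
        by (auto simp: abs_le_iff)
      have "(\<Sum>c\<in>C. a c *\<^sub>R c) = (\<Sum>c\<in>C. (a(b := t)) c *\<^sub>R c)"
        using insert.hyps by (intro sum.cong) auto
      then have "x = (\<Sum>c\<in>insert b C. (a(b := t)) c *\<^sub>R c)"
        using insert.hyps a(1) by simp
      moreover have "\<forall>c\<in>insert b C. \<bar>(a(b := t)) c\<bar> \<le> M"
        using a by simp
      ultimately show "x \<in> ?A"
        by blast
    qed
  qed
  moreover have "compact ?B"
    by (intro compact_continuous_image compact_Times insert.IH compact_Icc continuous_intros)
  ultimately show ?case
    by simp
qed

text \<open>The real span of \<open>B\<close> and \<open>i B\<close> is stable under
  \<open>i\<close>, hence a complex subspace. This makes real Gram-Schmidt available.\<close>

lemma real_span_eq_UNIV: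
  fixes B :: "'a::complex_vector set"
  assumes "complex_vector.span B = UNIV"
  shows "span (B \<union> (\<lambda>x. \<i> *\<^sub>C x) ` B) = UNIV"
proof -
  define V where "V = span (B \<union> (\<lambda>x. \<i> *\<^sub>C x) ` B)"
  have iV: "\<i> *\<^sub>C x \<in> V" if "x \<in> V" for x
    using that unfolding V_def
  proof (rule span_induct)
    show "subspace {x. \<i> *\<^sub>C x \<in> span (B \<union> (\<lambda>x. \<i> *\<^sub>C x) ` B)}"
      by (rule subspaceI)
         (auto simp: scaleC_add_right span_add span_zero span_scale scaleR_scaleC_commute[symmetric])
    show "\<i> *\<^sub>C x \<in> span (B \<union> (\<lambda>x. \<i> *\<^sub>C x) ` B)" if "x \<in> B \<union> (\<lambda>x. \<i> *\<^sub>C x) ` B" for x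
      using that
    proof
      assume "x \<in> (\<lambda>x. \<i> *\<^sub>C x) ` B"
      then obtain b where b: "b \<in> B" "\<i> *\<^sub>C x = - b"
        by (auto simp: scaleC_scaleC)
      show ?thesis
        unfolding b(2) using b(1) by (intro span_neg span_base) simp
    qed (auto intro: span_base)
  qed
  have "x \<in> V" for x
  proof -
    have "x \<in> complex_vector.span B"
      by (simp add: assms)
    then show ?thesis
    proof (rule complex_vector.span_induct)
      show "complex_vector.subspace {x. x \<in> V}"
      proof (rule complex_vector.subspaceI)
        fix c x assume "x \<in> {x. x \<in> V}"
        then have "Re c *\<^sub>R x + Im c *\<^sub>R \<i> *\<^sub>C x \<in> V"
          using iV[of x] unfolding V_def by (auto intro: span_add span_scale)
        moreover have "Re c *\<^sub>R x + Im c *\<^sub>R \<i> *\<^sub>C x = (of_real (Re c) + of_real (Im c) * \<i>) *\<^sub>C x"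
          by (simp add: scaleR_scaleC scaleC_scaleC scaleC_add_left)
        moreover have "of_real (Re c) + of_real (Im c) * \<i> = c"
          by (simp add: complex_eq_iff)
        ultimately show "c *\<^sub>C x \<in> {x. x \<in> V}"
          by simp
      qed (auto simp: V_def span_zero span_add)
    qed (auto simp: V_def intro: span_base)
  qed
  then show ?thesis
    by (auto simp: V_def)
qed

lemma compact_cball_finite_dim:
  assumes "finite_dim (UNIV :: 'k::complex_inner set)"
  shows "compact (cball (0::'k) 1)"
proof -
  obtain B where B: "finite B" "complex_vector.span B = (UNIV :: 'k set)"
    using assms unfolding finite_dim_def by blast
  obtain C :: "'k set" where C: "finite C" "span C = span (B \<union> (\<lambda>x. \<i> *\<^sub>C x) ` B)" "pairwise orthogonal C"
    using basis_orthogonal[of "B \<union> (\<lambda>x. \<i> *\<^sub>C x) ` B"] B(1) by auto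
  have C_UNIV: "span C = UNIV"
    using C(2) real_span_eq_UNIV[OF B(2)] by simp
  \<comment> \<open>By Cauchy-Schwarz the coefficient of a unit ball vector at \<open>c\<close> is
    at most \<open>1 / norm c\<close>; the sum dominates all of these at once.\<close>
  define M where "M = (\<Sum>c\<in>C. 1 / norm c)"
  have "cball (0::'k) 1 \<subseteq> {(\<Sum>c\<in>C. a c *\<^sub>R c) | a. \<forall>c\<in>C. \<bar>a c\<bar> \<le> M}"
  proof
    fix x :: 'k assume "x \<in> cball 0 1"
    then have x: "norm x \<le> 1"
      by simp
    have "\<bar>inner x c / inner c c\<bar> \<le> M" if "c \<in> C" for c
    proof -
      have "\<bar>inner x c\<bar> \<le> norm x * norm c"
        by (rule Cauchy_Schwarz_ineq2)
      also have "\<dots> \<le> 1 * norm c"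
        using x by (intro mult_right_mono) auto
      finally have "\<bar>inner x c\<bar> / (norm c)\<^sup>2 \<le> norm c / (norm c)\<^sup>2"
        by (intro divide_right_mono) auto
      also have "\<dots> = 1 / norm c"
        by (simp add: power2_eq_square)
      also have "\<dots> \<le> M"
        unfolding M_def using C(1) that by (intro member_le_sum) auto
      finally show ?thesis
        by (simp add: power2_norm_eq_inner)
    qed
    moreover have "x = (\<Sum>c\<in>C. (inner x c / inner c c) *\<^sub>R c)"
      by (rule orthogonal_expansion[OF C(1,3)]) (simp add: C_UNIV)
    ultimately show "x \<in> {(\<Sum>c\<in>C. a c *\<^sub>R c) | a. \<forall>c\<in>C. \<bar>a c\<bar> \<le> M}"
      by (intro CollectI exI[of _ "\<lambda>c. inner x c / inner c c"]) auto
  qed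
  then have eq: "{(\<Sum>c\<in>C. a c *\<^sub>R c) | a. \<forall>c\<in>C. \<bar>a c\<bar> \<le> M} \<inter> cball 0 1 = cball 0 1"
    by blast
  show ?thesis
    by (rule back_subst[of compact, OF compact_Int_closed[OF compact_bounded_combinations[OF C(1)] closed_cball] eq])
qed

text \<open>If there were no bound, normalised graph points would accumulate, by compactness of the unit
  sphere of \<open>K\<close>, at some \<open>(0, l)\<close> with \<open>\<parallel>l\<parallel> = 1\<close>.\<close>

lemma closed_ops_bounded:
  fixes T :: "('h::complex_hilbert \<times> 'k::complex_hilbert) set"
  assumes fin: "finite_dim (UNIV :: 'k set)" and T: "T \<in> closed_ops"
  shows "\<exists>M. \<forall>x y. (x, y) \<in> T \<longrightarrow> norm y \<le> M * norm x"
proof (rule ccontr)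
  assume no: "\<nexists>M. \<forall>x y. (x, y) \<in> T \<longrightarrow> norm y \<le> M * norm x"
  have lin: "linear_op T" and clo: "closed T"
    using T by (auto simp: closed_ops_def)
  have "\<exists>p\<in>T. norm (snd p) = 1 \<and> norm (fst p) < 1 / real (Suc n)" for n
  proof -
    obtain x y where xy: "(x, y) \<in> T" "real (Suc n) * norm x < norm y"
      using no by (meson not_le)
    then have y: "0 < norm y"
      by (smt (verit) mult_nonneg_nonneg norm_ge_zero of_nat_0_le_iff)
    have "((1 / norm y) *\<^sub>R x, (1 / norm y) *\<^sub>R y) \<in> T"
      using lin xy(1) unfolding linear_op_def scaleR_scaleC by blast
    moreover have "norm x / norm y < 1 / real (Suc n)"
      using xy(2) y by (simp add: field_simps)
    ultimately show ?thesis
      using y by (intro bexI[of _ "((1 / norm y) *\<^sub>R x, (1 / norm y) *\<^sub>R y)"]) auto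
  qed
  then obtain p where p: "\<And>n. p n \<in> T" "\<And>n. norm (snd (p n)) = 1"
      "\<And>n. norm (fst (p n)) < 1 / real (Suc n)"
    by metis
  have "(\<lambda>n. fst (p n)) \<longlonglongrightarrow> 0"
  proof (rule Lim_null_comparison[OF always_eventually LIMSEQ_inverse_real_of_nat], rule allI)
    show "norm (fst (p n)) \<le> inverse (real (Suc n))" for n
      using p(3)[of n] by (simp only: inverse_eq_divide less_imp_le)
  qed
  moreover have "\<forall>n. snd (p n) \<in> cball 0 1"
    using p(2) by simp
  then obtain l r where r: "strict_mono r" and l: "((\<lambda>n. snd (p n)) \<circ> r) \<longlonglongrightarrow> l"
    using compact_cball_finite_dim[OF fin] unfolding compact_eq_seq_compact_metric seq_compact_def
    by metis
  ultimately have "(\<lambda>n. (fst (p (r n)), snd (p (r n)))) \<longlonglongrightarrow> (0, l)"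
    using LIMSEQ_subseq_LIMSEQ[OF _ r] by (intro tendsto_Pair) (auto simp: o_def)
  then have "(0, l) \<in> T"
    using closed_sequentially[OF clo, of "\<lambda>n. p (r n)"] p(1) by simp
  then have "l = 0"
    using lin unfolding linear_op_def single_valued_def by blast
  moreover have "(\<lambda>n. norm (snd (p (r n)))) \<longlonglongrightarrow> norm l"
    using l by (auto simp: o_def intro: tendsto_norm)
  then have "norm l = 1"
    using p(2) by (simp add: LIMSEQ_const_iff)
  ultimately show False
    by simp
qed

text \<open>Approximate \<open>x\<close> from the dense domain: by the bound the images are Cauchy,
  and closedness puts the limit pair into \<open>T\<close>.\<close>

lemma closed_ops_everywhere_bounded:
  fixes T :: "('h::complex_hilbert \<times> 'k::complex_hilbert) set"
  assumes fin: "finite_dim (UNIV :: 'k set)" and T: "T \<in> closed_ops"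
  shows "\<exists>t. clin (blinfun_apply t) \<and> T = graph_of t"
proof -
  have lin: "linear_op T" and clo: "closed T" and dense: "closure (Domain T) = UNIV"
    using T by (auto simp: closed_ops_def densely_defined_def)
  have add: "(x + x', y + y') \<in> T" if "(x, y) \<in> T" "(x', y') \<in> T" for x x' y y'
    using lin that unfolding linear_op_def by blast
  have scale: "(c *\<^sub>C x, c *\<^sub>C y) \<in> T" if "(x, y) \<in> T" for c x y
    using lin that unfolding linear_op_def by blast
  have diff: "(x - x', y - y') \<in> T" if "(x, y) \<in> T" "(x', y') \<in> T" for x x' y y'
    using add[OF that(1) scale[OF that(2), of "-1"]] by simp
  obtain M where M: "\<And>x y. (x, y) \<in> T \<Longrightarrow> norm y \<le> M * norm x"
    using closed_ops_bounded[OF assms] by blast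
  have "\<exists>y. (x, y) \<in> T" for x
  proof -
    obtain X where X: "\<And>n. X n \<in> Domain T" "X \<longlonglongrightarrow> x"
      using dense closure_sequential[of x "Domain T"] by auto
    then obtain Y where Y: "\<And>n. (X n, Y n) \<in> T"
      unfolding Domain_iff by metis
    have "Cauchy Y"
    proof (rule metric_CauchyI)
      fix e :: real assume "0 < e"
      then obtain N where N: "\<And>m n. N \<le> m \<Longrightarrow> N \<le> n \<Longrightarrow> dist (X m) (X n) < e / (\<bar>M\<bar> + 1)"
        using metric_CauchyD[OF LIMSEQ_imp_Cauchy[OF X(2)], of "e / (\<bar>M\<bar> + 1)"]
        by (metis abs_ge_zero add_nonneg_pos divide_pos_pos zero_less_one)
      have "dist (Y m) (Y n) < e" if "N \<le> m" "N \<le> n" for m n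
      proof -
        have "dist (Y m) (Y n) \<le> M * dist (X m) (X n)"
          using M[OF diff[OF Y[of m] Y[of n]]] by (simp add: dist_norm)
        also have "\<dots> \<le> (\<bar>M\<bar> + 1) * dist (X m) (X n)"
          by (intro mult_right_mono) auto
        also have "\<dots> < e"
          using N[OF that] by (simp add: field_simps add_nonneg_pos)
        finally show ?thesis .
      qed
      then show "\<exists>N. \<forall>m\<ge>N. \<forall>n\<ge>N. dist (Y m) (Y n) < e"
        by blast
    qed
    then obtain y where "Y \<longlonglongrightarrow> y"
      using Cauchy_convergent_iff convergent_def by blast
    then have "(\<lambda>n. (X n, Y n)) \<longlonglongrightarrow> (x, y)"
      using X(2) by (intro tendsto_Pair)
    then have "(x, y) \<in> T"
      using closed_sequentially[OF clo, of "\<lambda>n. (X n, Y n)"] Y by blast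
    then show ?thesis ..
  qed
  then obtain f where f: "\<And>x. (x, f x) \<in> T"
    by metis
  have f_iff: "(x, y) \<in> T \<longleftrightarrow> y = f x" for x y
    using lin f single_valuedD[of T x y "f x"] unfolding linear_op_def by blast
  have "bounded_linear f"
  proof (rule bounded_linear_intro)
    show "f (x + y) = f x + f y" for x y
      using add[OF f f] by (simp add: f_iff)
    show "f (r *\<^sub>R x) = r *\<^sub>R f x" for r x
      using scale[OF f] by (simp add: f_iff scaleR_scaleC)
    show "norm (f x) \<le> norm x * M" for x
      using M[OF f[of x]] by (simp add: mult.commute)
  qed
  then have t: "blinfun_apply (Blinfun f) = f"
    by (rule bounded_linear_Blinfun_apply)
  have "clin f"
    using scale[OF f] by (simp add: f_iff clin_def)
  moreover have "T = graph_of (Blinfun f)"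
    using f_iff by (auto simp: mem_graph_of t)
  ultimately show ?thesis
    using t by metis
qed

section \<open>The metric on closed operators\<close>

text \<open>The inverse of \<open>Q\<^sup>2\<close> is \<open>I - hat* hat\<close>, so
  \<open>hat\<close> determines \<open>Q\<^sup>2\<close>. The locale does not record positivity of
  \<open>Q\<close>, hence the conclusion about squares.\<close>

lemma (in ball_automorphism) hat_inject:
  assumes S: "ball_automorphism S S' R R' W W'" and eq: "hat = ball_automorphism.hat S' R'"
  shows "Q o\<^sub>L Q = W o\<^sub>L W"
proof (rule blinfun_eqI)
  interpret S: ball_automorphism S S' R R' W W' by fact
  have Q': "inner (Q' m) (Q' n) = inner m n - inner (hat m) (hat n)" for m n
  proof -
    have "inner (Q (Q' m)) (Q (Q' n)) = inner (Q' m) (Q' n) + inner (T' (Q' m)) (T' (Q' n))"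
      by (rule inner_QQ)
    then show ?thesis
      unfolding hat_Q[symmetric] inv by simp
  qed
  have W': "inner (W' m) (W' n) = inner m n - inner (hat m) (hat n)" for m n
  proof -
    have "inner (W (W' m)) (W (W' n)) = inner (W' m) (W' n) + inner (S' (W' m)) (S' (W' n))"
      by (rule S.inner_QQ)
    then show ?thesis
      unfolding S.hat_Q[symmetric] S.inv eq by simp
  qed
  have Q'_sa: "inner (Q' m) n = inner m (Q' n)" for m n
    by (metis sa(2) inv(3))
  have W'_sa: "inner (W' m) n = inner m (W' n)" for m n
    by (metis S.sa(2) S.inv(3))
  have *: "Q' (Q' m) = W' (W' m)" for m
  proof (rule vector_eq_ldot[THEN iffD1, rule_format])
    show "inner z (Q' (Q' m)) = inner z (W' (W' m))" for z
      by (simp only: Q'_sa[of z "Q' m", symmetric] W'_sa[of z "W' m", symmetric] Q' W')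
  qed
  fix k
  have "Q (Q (Q' (Q' (W (W k))))) = Q (Q k)"
    unfolding * S.inv ..
  then show "(Q o\<^sub>L Q) k = (W o\<^sub>L W) k"
    by (simp add: inv)
qed

text \<open>For \<open>y = S.hat\<close> one has \<open>S' = y W\<close>. So numerator and
  denominator are \<open>(P y - T') W\<close> and \<open>den y W\<close>, and \<open>W\<close>
  cancels.\<close>

lemma (in ball_automorphism) L_R_inverse:
  assumes S: "ball_automorphism S S' R R' W W'"
  shows "graph_of ((P o\<^sub>L S') - (T' o\<^sub>L W)) \<odot>\<^sub>o (graph_of ((Q o\<^sub>L W) - (T o\<^sub>L S')))\<inverse> =
    graph_of (frac (ball_automorphism.hat S' R'))"
proof -
  interpret S: ball_automorphism S S' R R' W W' by fact
  let ?y = S.hat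
  have den: "den ?y (W k) = Q (W k) - T (S' k)" for k
    by (simp add: den_apply S.hat_Q)
  have inv_den: "inverse_ops (den ?y) (iden ?y)"
    by (rule iden[OF S.norm_hat])
  have "inverse_ops ((Q o\<^sub>L W) - (T o\<^sub>L S')) (W' o\<^sub>L iden ?y)"
    unfolding inverse_ops_def
  proof (intro conjI allI)
    fix k
    have eq: "((Q o\<^sub>L W) - (T o\<^sub>L S')) m = den ?y (W m)" for m
      by (simp add: den blinfun.diff_left)
    show "((Q o\<^sub>L W) - (T o\<^sub>L S')) ((W' o\<^sub>L iden ?y) k) = k"
      unfolding eq using inv_den by (simp add: S.inv inverse_ops_def)
    show "(W' o\<^sub>L iden ?y) (((Q o\<^sub>L W) - (T o\<^sub>L S')) k) = k"
      unfolding eq using inv_den by (simp add: S.inv inverse_ops_def)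
  qed
  moreover have "frac ?y = ((P o\<^sub>L S') - (T' o\<^sub>L W)) o\<^sub>L (W' o\<^sub>L iden ?y)"
  proof (rule frac_unique[OF S.norm_hat])
    fix k
    have "S' (W' k) = ?y k"
      using S.hat_Q[of "W' k"] by (simp add: S.inv)
    moreover have "iden ?y (den ?y k) = k"
      using inv_den by (simp add: inverse_ops_def)
    ultimately show "(((P o\<^sub>L S') - (T' o\<^sub>L W)) o\<^sub>L (W' o\<^sub>L iden ?y)) (den ?y k) = P (?y k) - T' k"
      by (simp add: blinfun.diff_left S.inv)
  qed
  ultimately show ?thesis
    by (simp add: converse_graph_of op_comp_graph_of)
qed

text \<open>The last conjunct recovers \<open>Q\<close> from \<open>Q o\<^sub>L Q\<close>,
  complementing \<open>hat_inject\<close>.\<close>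

lemma closed_ops_automorphism:
  fixes T :: "('h::complex_hilbert \<times> 'k::complex_hilbert) set"
  assumes "finite_dim (UNIV :: 'k set)" "T \<in> closed_ops"
  shows "\<exists>t t' P P' Q Q'. ball_automorphism t t' P P' Q Q' \<and> T = graph_of t \<and>
    op_adjoint T = graph_of t' \<and> op_sqrt (Id \<oplus>\<^sub>o op_adjoint T \<odot>\<^sub>o T) = graph_of P \<and>
    op_sqrt (Id \<oplus>\<^sub>o T \<odot>\<^sub>o op_adjoint T) = graph_of Q \<and>
    op_sqrt (graph_of (Q o\<^sub>L Q)) = graph_of Q"
proof -
  obtain t where t: "clin (blinfun_apply t)" "T = graph_of t"
    using closed_ops_everywhere_bounded[OF assms] by blast
  obtain P P' Q Q' where aut: "ball_automorphism t (adj t) P P' Q Q'"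
    and P: "op_sqrt (Id \<oplus>\<^sub>o op_adjoint (graph_of t) \<odot>\<^sub>o graph_of t) = graph_of P"
    and Q: "op_sqrt (Id \<oplus>\<^sub>o graph_of t \<odot>\<^sub>o op_adjoint (graph_of t)) = graph_of Q"
    using ball_automorphism_exists[OF t(1)] by blast
  interpret ball_automorphism t "adj t" P P' Q Q' by fact
  have adjoint: "op_adjoint (graph_of t) = graph_of (adj t)"
    by (rule op_adjoint_graph_of[OF t(1) adj])
  have "id_blinfun + (t o\<^sub>L adj t) = Q o\<^sub>L Q"
    by (rule blinfun_eqI) (simp add: blinfun.add_left QQ)
  then have "op_sqrt (graph_of (Q o\<^sub>L Q)) = graph_of Q"
    using Q by (simp add: adjoint Id_eq_graph_of op_comp_graph_of op_add_graph_of)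
  then show ?thesis
    using aut t(2) P Q adjoint by blast
qed

lemma closed_ops_transform:
  fixes T :: "('h::complex_hilbert \<times> 'k::complex_hilbert) set"
  assumes fin: "finite_dim (UNIV :: 'k set)" and T: "T \<in> closed_ops"
  shows "\<exists>t t' P P' Q Q'. ball_automorphism t t' P P' Q Q' \<and>
    bounded_op (op_hat T) = ball_automorphism.hat t' P' \<and>
    (\<forall>S\<in>closed_ops. op_L T S \<odot>\<^sub>o (op_R S T)\<inverse> =
       graph_of (ball_automorphism.frac t t' P Q (bounded_op (op_hat S)))) \<and>
    (\<forall>S\<in>closed_ops. bounded_op (op_hat S) = bounded_op (op_hat T) \<longrightarrow> S = T)"
proof -
  have hat: "bounded_op (op_hat S) = ball_automorphism.hat s' R'"
    if aut: "ball_automorphism s s' R R' W W'" and "op_adjoint S = graph_of s'"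
      "op_sqrt (Id \<oplus>\<^sub>o op_adjoint S \<odot>\<^sub>o S) = graph_of R"
    for S :: "('h \<times> 'k) set" and s s' R R' W W'
  proof -
    interpret S: ball_automorphism s s' R R' W W' by fact
    have "op_hat S = graph_of (R' o\<^sub>L s')"
      using that(2,3) by (simp add: op_hat_def converse_graph_of[OF S.inverse(1)] op_comp_graph_of)
    then show ?thesis
      by (simp add: bounded_op_graph_of S.hat_def)
  qed
  obtain t t' P P' Q Q' where aut: "ball_automorphism t t' P P' Q Q'" and
    T_eq: "T = graph_of t" "op_adjoint T = graph_of t'"
      "op_sqrt (Id \<oplus>\<^sub>o op_adjoint T \<odot>\<^sub>o T) = graph_of P"
      "op_sqrt (Id \<oplus>\<^sub>o T \<odot>\<^sub>o op_adjoint T) = graph_of Q"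
      "op_sqrt (graph_of (Q o\<^sub>L Q)) = graph_of Q"
    using closed_ops_automorphism[OF assms] by blast
  interpret T: ball_automorphism t t' P P' Q Q' by fact
  have hat_T: "bounded_op (op_hat T) = T.hat"
    by (rule hat[OF aut T_eq(2,3)])
  have S: "op_L T S \<odot>\<^sub>o (op_R S T)\<inverse> = graph_of (T.frac (bounded_op (op_hat S))) \<and>
      (bounded_op (op_hat S) = bounded_op (op_hat T) \<longrightarrow> S = T)"
    if S: "S \<in> closed_ops" for S
  proof -
    obtain s s' R R' W W' where aut': "ball_automorphism s s' R R' W W'" and
      S_eq: "S = graph_of s" "op_adjoint S = graph_of s'"
        "op_sqrt (Id \<oplus>\<^sub>o op_adjoint S \<odot>\<^sub>o S) = graph_of R"
        "op_sqrt (Id \<oplus>\<^sub>o S \<odot>\<^sub>o op_adjoint S) = graph_of W"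
        "op_sqrt (graph_of (W o\<^sub>L W)) = graph_of W"
      using closed_ops_automorphism[OF fin S] by blast
    interpret S: ball_automorphism s s' R R' W W' by fact
    have hat_S: "bounded_op (op_hat S) = S.hat"
      by (rule hat[OF aut' S_eq(2,3)])
    have "op_L T S = graph_of ((P o\<^sub>L s') - (t' o\<^sub>L W))"
      unfolding op_L_def T_eq(3) S_eq(4) unfolding T_eq(2) S_eq(2)
      by (simp add: op_comp_graph_of op_diff_graph_of)
    moreover have "op_R S T = graph_of ((Q o\<^sub>L W) - (t o\<^sub>L s'))"
      unfolding op_R_def T_eq(4) S_eq(4) unfolding T_eq(1) S_eq(2)
      by (simp add: op_comp_graph_of op_diff_graph_of)
    ultimately have "op_L T S \<odot>\<^sub>o (op_R S T)\<inverse> = graph_of (T.frac S.hat)"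
      using T.L_R_inverse[OF aut'] by simp
    \<comment> \<open>The transform determines \<open>Q\<close>, then the adjoint through
      \<open>hat (Q k) = t' k\<close>, and so the operator.\<close>
    moreover have "S = T" if eq: "S.hat = T.hat"
    proof -
      have "Q o\<^sub>L Q = W o\<^sub>L W"
        by (rule T.hat_inject[OF aut' eq[symmetric]])
      then have QW: "Q = W"
        using T_eq(5) S_eq(5) by (metis graph_of_inject)
      have adj_eq: "t' k = s' k" for k
        by (metis S.hat_Q T.hat_Q QW eq)
      have "t h = s h" for h
        by (rule vector_eq_rdot[THEN iffD1]) (simp add: T.adjoint S.adjoint adj_eq)
      then show ?thesis
        using T_eq(1) S_eq(1) blinfun_eqI by metis
    qed
    ultimately show ?thesis
      unfolding hat_S hat_T by blast
  qed
  show ?thesis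
    by (rule exI[of _ t], rule exI[of _ t'], rule exI[of _ P], rule exI[of _ P'], rule exI[of _ Q],
        rule exI[of _ Q'])
       (intro conjI ballI impI aut hat_T S[THEN conjunct1] S[THEN conjunct2, THEN mp])
qed

lemma op_hat_in_ball:
  fixes T :: "('h::complex_hilbert \<times> 'k::complex_hilbert) set"
  assumes fin: "finite_dim (UNIV :: 'k set)" and "T \<in> closed_ops"
  shows "bounded_op (op_hat T) \<in> op_unit_ball"
proof -
  obtain t t' P P' Q Q' where "ball_automorphism t t' P P' Q Q'"
    "bounded_op (op_hat T) = ball_automorphism.hat t' P'"
    using closed_ops_transform[OF assms] by (elim exE conjE) (rule that)
  then show ?thesis
    by (simp add: ball_automorphism.hat_in_ball)
qed

text \<open>The last two conclusions together say that \<open>op_dist T S\<close> is a least upper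
  bound over disc functions; the metric axioms use it in this form.\<close>

lemma op_dist_frac:
  fixes T S :: "('h::complex_hilbert \<times> 'k::complex_hilbert) set"
  assumes fin: "finite_dim (UNIV :: 'k set)" and T: "T \<in> closed_ops" and S: "S \<in> closed_ops"
  shows "\<exists>A\<in>op_unit_ball. graph_of A = op_L T S \<odot>\<^sub>o (op_R S T)\<inverse>"
    and "ereal (op_dist T S) = kobayashi op_unit_ball (bounded_op (op_hat T)) (bounded_op (op_hat S))"
    and "0 \<le> op_dist T S" and "op_dist T S = 0 \<longleftrightarrow> T = S"
    and "disc_function F \<Longrightarrow>
      poincare_dist (F (bounded_op (op_hat T))) (F (bounded_op (op_hat S))) \<le> op_dist T S"
    and "(\<And>F. disc_function F \<Longrightarrow>
      poincare_dist (F (bounded_op (op_hat T))) (F (bounded_op (op_hat S))) \<le> r) \<Longrightarrow>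
      op_dist T S \<le> r"
proof -
  obtain t t' P P' Q Q' where aut: "ball_automorphism t t' P P' Q Q'"
    and hat: "bounded_op (op_hat T) = ball_automorphism.hat t' P'"
    and LR: "\<forall>S\<in>closed_ops. op_L T S \<odot>\<^sub>o (op_R S T)\<inverse> =
      graph_of (ball_automorphism.frac t t' P Q (bounded_op (op_hat S)))"
    and inj: "\<forall>S\<in>closed_ops. bounded_op (op_hat S) = bounded_op (op_hat T) \<longrightarrow> S = T"
    using closed_ops_transform[OF fin T]
    by (elim exE conjE) (rule that)
  interpret ball_automorphism t t' P P' Q Q' by fact
  note LR = LR[rule_format, OF S] and inj = inj[rule_format, OF S]
  have ball: "bounded_op (op_hat S) \<in> op_unit_ball"
    by (rule op_hat_in_ball[OF fin S])
  have dist: "op_dist T S = artanh (norm (frac (bounded_op (op_hat S))))"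
    by (simp add: op_dist_def LR bounded_op_graph_of)
  have n: "norm (frac (bounded_op (op_hat S))) < 1" "norm (bounded_op (op_hat S)) < 1"
    using frac_in_ball[OF ball] ball by (auto simp: op_unit_ball_iff)
  show "\<exists>A\<in>op_unit_ball. graph_of A = op_L T S \<odot>\<^sub>o (op_R S T)\<inverse>"
    using LR frac_in_ball[OF ball] by metis
  show "ereal (op_dist T S) = kobayashi op_unit_ball (bounded_op (op_hat T)) (bounded_op (op_hat S))"
    unfolding hat dist by (rule kobayashi_hat[OF ball, symmetric])
  show "0 \<le> op_dist T S"
    unfolding dist using n by (intro artanh_real_nonneg) auto
  show "disc_function F \<Longrightarrow>
      poincare_dist (F (bounded_op (op_hat T))) (F (bounded_op (op_hat S))) \<le> op_dist T S"
    unfolding hat dist by (rule disc_function_le[OF _ ball])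
  show "(\<And>F. disc_function F \<Longrightarrow>
      poincare_dist (F (bounded_op (op_hat T))) (F (bounded_op (op_hat S))) \<le> r) \<Longrightarrow>
      op_dist T S \<le> r"
    unfolding hat dist by (rule artanh_norm_frac_le[OF ball])
  show "op_dist T S = 0 \<longleftrightarrow> T = S"
  proof
    assume "op_dist T S = 0"
    then have "artanh (norm (frac (bounded_op (op_hat S)))) \<le> artanh 0"
      by (simp add: dist)
    then have "frac (bounded_op (op_hat S)) = 0"
      using n by (simp add: artanh_real_le_iff del: artanh_0)
    then show "T = S"
      using frac_eq_0[OF n(2)] hat inj by simp
  next
    assume "T = S"
    then have "frac (bounded_op (op_hat S)) = 0"
      using frac_hat hat by simp
    then show "op_dist T S = 0"
      by (simp add: dist)
  qed
qed

lemma op_dist_le_swap: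
  fixes T S :: "('h::complex_hilbert \<times> 'k::complex_hilbert) set"
  assumes fin: "finite_dim (UNIV :: 'k set)" and T: "T \<in> closed_ops" and S: "S \<in> closed_ops"
  shows "op_dist T S \<le> op_dist S T"
  by (rule op_dist_frac(6)[OF assms]) (subst poincare_dist_commute, rule op_dist_frac(5)[OF fin S T])

lemma op_dist_triangle:
  fixes T U S :: "('h::complex_hilbert \<times> 'k::complex_hilbert) set"
  assumes fin: "finite_dim (UNIV :: 'k set)" and mem: "T \<in> closed_ops" "U \<in> closed_ops" "S \<in> closed_ops"
  shows "op_dist T S \<le> op_dist T U + op_dist U S"
proof (rule op_dist_frac(6)[OF fin mem(1,3)])
  fix F :: "('k \<Rightarrow>\<^sub>L 'h) \<Rightarrow> complex" assume F: "disc_function F"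
  then have "F (bounded_op (op_hat V)) \<in> ball 0 1" if "V \<in> closed_ops" for V
    using op_hat_in_ball[OF fin that] unfolding disc_function_def by blast
  then have "poincare_dist (F (bounded_op (op_hat T))) (F (bounded_op (op_hat S))) \<le>
      poincare_dist (F (bounded_op (op_hat T))) (F (bounded_op (op_hat U))) +
      poincare_dist (F (bounded_op (op_hat U))) (F (bounded_op (op_hat S)))"
    using mem by (intro poincare_dist_triangle)
  also have "\<dots> \<le> op_dist T U + op_dist U S"
    using mem F by (intro add_mono op_dist_frac(5) fin)
  finally show "poincare_dist (F (bounded_op (op_hat T))) (F (bounded_op (op_hat S))) \<le> op_dist T U + op_dist U S" .
qed

text \<open>\<open>Metric_space\<close> demands nonnegativity and symmetry for all arguments, also
  outside the carrier; hence the value 0 there.\<close>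

lemma op_dist_metric:
  assumes fin: "finite_dim (UNIV :: 'k::complex_hilbert set)"
  shows "Metric_space closed_ops (\<lambda>T S :: ('h::complex_hilbert \<times> 'k) set.
    if T \<in> closed_ops \<and> S \<in> closed_ops then op_dist T S else 0)"
proof
  show "0 \<le> (if T \<in> closed_ops \<and> S \<in> closed_ops then op_dist T S else 0)" for T S :: "('h \<times> 'k) set"
    using op_dist_frac(3)[OF fin, of T S] by simp
  show "(if T \<in> closed_ops \<and> S \<in> closed_ops then op_dist T S else 0) =
      (if S \<in> closed_ops \<and> T \<in> closed_ops then op_dist S T else 0)"
    for T S :: "('h \<times> 'k) set"
    using op_dist_le_swap[OF fin, of T S] op_dist_le_swap[OF fin, of S T] by auto
qed (simp_all add: op_dist_frac(4)[OF fin] op_dist_triangle[OF fin])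

text \<open>The first conjunct certifies that the description in \<open>op_dist\<close> denotes an
  actual operator and that \<open>artanh\<close> is applied below 1.\<close>

theorem theorem3p3:
  fixes C :: "('h::complex_hilbert \<times> 'k::complex_hilbert) set set"
  defines "C \<equiv> closed_ops"
  assumes "finite_dim (UNIV :: 'k set)"
  shows "(\<forall>T\<in>C. \<forall>S\<in>C. \<exists>A\<in>op_unit_ball. graph_of A = op_L T S \<odot>\<^sub>o (op_R S T)\<inverse>) \<and>
         Metric_space C (\<lambda>T S. if T \<in> C \<and> S \<in> C then op_dist T S else 0) \<and>
         (\<forall>T\<in>C. \<forall>S\<in>C.
            ereal (op_dist T S) =
              kobayashi op_unit_ball (bounded_op (op_hat T)) (bounded_op (op_hat S)))"
  unfolding C_def
  by (intro conjI ballI op_dist_metric op_dist_frac(1,2) assms(2))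

end
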